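(* Let $G$ be an arbitrary finite group of odd order $2k+1$, where $k\ge 3$. Then $G$ has a real representation $R$ of degree $d=2^{2^{k-1}}$ such that the elements $R(\sigma)$, $\sigma\in G$, define $|G|$ mutually unbiased bases in $\mathbb{R}^{d}$.
   Context: Two orthonormal bases $\{u_1,\dots,u_d\}$ and $\{v_1,\dots,v_d\}$ of $\mathbb{R}^d$ are mutually unbiased if $\langle u_i,v_j\rangle^2=1/d$ for all $1\le i,j\le d$. A $d\times d$ real orthogonal matrix is identified with an orthonormal basis of $\mathbb{R}^d$. The bases corresponding to orthogonal matrices $O_1,O_2$ are mutually unbiased if and only if every entry of $O_1O_2^{-1}$ equals $\pm1/\sqrt d$. Saying that the elements $R(\sigma)$, $\sigma\in G$, define $|G|$ mutually unbiased bases means that each $R(\sigma)$ is a real orthogonal $d\times d$ matrix and that for distinct $\sigma,\tau\in G$ the bases corresponding to $R(\sigma)$ and $R(\tau)$ are mutually unbiased. *)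

theory Defs
  imports "Jordan_Normal_Form.VS_Connect"
begin

text \<open>
  The degree depends on the order of the group, so vectors and matrices are taken from
  \<^theory>\<open>Jordan_Normal_Form.Matrix\<close>, where the dimension is a term; indices range over
  \<open>{..<d}\<close>.
\<close>

definition orthonormal_basis :: "nat \<Rightarrow> (nat \<Rightarrow> real vec) \<Rightarrow> bool" where
  "orthonormal_basis d u \<longleftrightarrow>
     vectorspace.basis class_ring (module_vec TYPE(real) d) (u ` {..<d}) \<and>
     (\<forall>i<d. \<forall>j<d. u i \<bullet> u j = (if i = j then 1 else 0))"

definition mutually_unbiased ::
    "nat \<Rightarrow> (nat \<Rightarrow> real vec) \<Rightarrow> (nat \<Rightarrow> real vec) \<Rightarrow> bool" where
  "mutually_unbiased d u v \<longleftrightarrow>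
     orthonormal_basis d u \<and> orthonormal_basis d v \<and>
     (\<forall>i<d. \<forall>j<d. (u i \<bullet> v j)\<^sup>2 = 1 / real d)"

text \<open>
  This is stronger than \<^const>\<open>orthogonal_mat\<close>, which only asks for pairwise orthogonal,
  nonzero columns.
\<close>

definition real_orthogonal_mat :: "nat \<Rightarrow> real mat \<Rightarrow> bool" where
  "real_orthogonal_mat d A \<longleftrightarrow>
     A \<in> carrier_mat d d \<and> A\<^sup>T * A = 1\<^sub>m d \<and> A * A\<^sup>T = 1\<^sub>m d"

text \<open>
  The basis of an orthogonal matrix consists of its rows: the entries of
  \<open>A * inverse B = A * B\<^sup>T\<close> are the inner products of the rows of \<open>A\<close> with those of \<open>B\<close>,
  so the bases of \<open>A\<close> and \<open>B\<close> are mutually unbiased iff all these entries are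
  \<open>\<plusminus> 1 / sqrt d\<close>.
\<close>

definition basis_of_mat :: "real mat \<Rightarrow> nat \<Rightarrow> real vec" where
  "basis_of_mat A = row A"

definition GL_real :: "nat \<Rightarrow> real mat monoid" where
  "GL_real d = units_of (ring_mat TYPE(real) d ())"

definition real_representation :: "('a, 'b) monoid_scheme \<Rightarrow> nat \<Rightarrow> ('a \<Rightarrow> real mat) \<Rightarrow> bool" where
  "real_representation G d R \<longleftrightarrow> R \<in> hom G (GL_real d)"

definition defines_MUBs :: "('a, 'b) monoid_scheme \<Rightarrow> nat \<Rightarrow> ('a \<Rightarrow> real mat) \<Rightarrow> bool" where
  "defines_MUBs G d R \<longleftrightarrow>
     (\<forall>\<sigma>\<in>carrier G. real_orthogonal_mat d (R \<sigma>)) \<and>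
     (\<forall>\<sigma>\<in>carrier G. \<forall>\<tau>\<in>carrier G. \<sigma> \<noteq> \<tau> \<longrightarrow>
        mutually_unbiased d (basis_of_mat (R \<sigma>)) (basis_of_mat (R \<tau>)))"

end

theory Submission
  imports Defs "HOL-Library.Z2" "HOL-Library.Function_Algebras" "HOL-Combinatorics.Permutations"
begin

text \<open>
  Over the field with two elements, the Clifford algebra with generators \<open>e\<^sub>\<sigma>\<close> for \<open>\<sigma> \<in> G\<close> and
  relations \<open>e\<^sub>\<sigma>\<^sup>2 = 0\<close>, \<open>e\<^sub>\<sigma> e\<^sub>\<tau> + e\<^sub>\<tau> e\<^sub>\<sigma> = 1\<close> acts irreducibly on a spin module \<open>V\<close> of dimension
  \<open>2^k\<close>. Permutations of the generators lift uniquely to \<open>V\<close>, since 1 is the only nonzero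
  scalar; so \<open>G\<close> acts on \<open>V\<close>, and for \<open>k \<ge> 3\<close> it preserves a quadratic form. The kernel \<open>W\<close> of
  \<open>e\<^sub>1\<close> is totally singular of dimension \<open>2^(k-1)\<close>, and the relations give \<open>W \<inter> \<sigma>W = 0\<close> for
  \<open>\<sigma> \<noteq> 1\<close>.

  Averaging over \<open>G\<close>, which has odd order, produces a \<open>G\<close>-invariant bilinear form whose diagonal is
  the quadratic form; it defines a real twisted group algebra of \<open>V\<close>, a matrix algebra of degree
  \<open>d = \<bar>W\<bar>\<close>, on which \<open>G\<close> acts. Its irreducible module consists of the functions on \<open>V\<close>
  that are equivariant under \<open>W\<close>. Translating such functions by \<open>\<sigma>\<close> and projecting back
  gives a projective representation of \<open>G\<close>, whose matrices have entries \<open>\<plusminus> 1 / sqrt d\<close> for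
  \<open>\<sigma> \<noteq> 1\<close> because a coset of \<open>W\<close> and a coset of \<open>\<sigma>W\<close> meet in exactly one point. The
  remaining sign cocycle splits because the order of \<open>G\<close> is odd.
\<close>

section \<open>Projective representations of groups of odd order\<close>

lemma scalar_prod_rows_mult_transpose:
  fixes A B :: "real mat"
  assumes "A \<in> carrier_mat d d" "B \<in> carrier_mat d d" "i < d" "j < d"
  shows "row A i \<bullet> row B j = (A * B\<^sup>T) $$ (i, j)"
  using assms by simp

text \<open>\<open>A * A\<^sup>T = 1\<^sub>m d\<close> makes the determinant nonzero, so the rows
  are independent, and \<open>d\<close> independent vectors span a space of dimension
  \<open>d\<close>.\<close>

lemma orthonormal_basis_rows:
  assumes A: "real_orthogonal_mat d A"
  shows "orthonormal_basis d (row A)"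
proof -
  interpret vec_space "TYPE(real)" d .
  have Ac: "A \<in> carrier_mat d d" and AAT: "A * A\<^sup>T = 1\<^sub>m d"
    using A by (auto simp: real_orthogonal_mat_def)
  have dot: "row A i \<bullet> row A j = (if i = j then 1 else 0)" if "i < d" "j < d" for i j
    using scalar_prod_rows_mult_transpose[OF Ac Ac that] that by (simp add: AAT)
  have inj: "inj_on (row A) {..<d}"
    by (intro inj_onI) (metis dot lessThan_iff zero_neq_one)
  have sub: "row A ` {..<d} \<subseteq> carrier V"
    using Ac by auto
  have "det A * det (A\<^sup>T) = 1"
    using Ac AAT by (simp flip: det_mult[of _ d])
  then have "lin_indpt (set (rows A))"
    using Ac by (intro det_not_0_imp_lin_indpt_rows) auto
  moreover have "set (rows A) = row A ` {..<d}"
    using Ac by (auto simp: rows_def)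
  ultimately have "lin_indpt (row A ` {..<d})"
    by simp
  then have "basis (row A ` {..<d})"
    using sub by (intro dim_li_is_basis) (auto simp: dim_is_n card_image[OF inj])
  then show ?thesis
    by (simp add: orthonormal_basis_def dot)
qed

lemma transpose_smult_mat:
  fixes A :: "'a :: times mat"
  shows "(a \<cdot>\<^sub>m A)\<^sup>T = a \<cdot>\<^sub>m A\<^sup>T"
  by (intro eq_matI) auto

lemma smult_smult_mat:
  fixes A :: "'a :: semigroup_mult mat"
  shows "a \<cdot>\<^sub>m (b \<cdot>\<^sub>m A) = (a * b) \<cdot>\<^sub>m A"
  by (intro eq_matI) (auto simp: mult.assoc)

text \<open>Multiplication by the transpose leaves scalar matrices, whose corner entries are
  compared; \<open>0 < d\<close> guarantees a corner. The cocycle identity is read off from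
  associativity in this way.\<close>

lemma real_orthogonal_mat_smult_cancel:
  assumes "real_orthogonal_mat d A" "0 < d" "a \<cdot>\<^sub>m A = b \<cdot>\<^sub>m A"
  shows "a = b"
proof -
  have A: "A \<in> carrier_mat d d" "A * A\<^sup>T = 1\<^sub>m d"
    using assms(1) by (auto simp: real_orthogonal_mat_def)
  have "x \<cdot>\<^sub>m A * A\<^sup>T = x \<cdot>\<^sub>m 1\<^sub>m d" for x
    using A by (metis mult_smult_assoc_mat transpose_carrier_mat)
  then have "a \<cdot>\<^sub>m 1\<^sub>m d = b \<cdot>\<^sub>m (1\<^sub>m d :: real mat)"
    by (metis assms(3))
  then have "(a \<cdot>\<^sub>m 1\<^sub>m d) $$ (0, 0) = (b \<cdot>\<^sub>m (1\<^sub>m d :: real mat)) $$ (0, 0)"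
    by simp
  then show ?thesis
    using assms(2) by simp
qed

text \<open>
  Multiplying the cocycle identity over the third argument exhibits \<open>c ^ order G\<close>, which equals
  \<open>c\<close>, as the coboundary of \<open>\<mu> s = (\<Prod>t. c s t)\<close>.
\<close>

lemma sign_cocycle_odd_order:
  fixes G (structure) and c :: "'a \<Rightarrow> 'a \<Rightarrow> real"
  assumes "group G" "finite (carrier G)" "odd (Coset.order G)"
    and sign: "\<And>s t. s \<in> carrier G \<Longrightarrow> t \<in> carrier G \<Longrightarrow> c s t \<in> {1, -1}"
    and cocycle: "\<And>s t u. s \<in> carrier G \<Longrightarrow> t \<in> carrier G \<Longrightarrow> u \<in> carrier G \<Longrightarrow>
      c s t * c (s \<otimes> t) u = c t u * c s (t \<otimes> u)"
  obtains \<mu> :: "'a \<Rightarrow> real" where "\<And>s. s \<in> carrier G \<Longrightarrow> \<mu> s \<in> {1, -1}"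
    and "\<And>s t. s \<in> carrier G \<Longrightarrow> t \<in> carrier G \<Longrightarrow> \<mu> s * \<mu> t * c s t = \<mu> (s \<otimes> t)"
proof
  interpret group G by fact
  define \<mu> where "\<mu> s = (\<Prod>u\<in>carrier G. c s u)" for s
  show mu: "\<mu> s \<in> {1, -1}" if "s \<in> carrier G" for s
  proof -
    have "(\<Prod>u\<in>A. c s u) \<in> {1, -1}" if "A \<subseteq> carrier G" for A
      using finite_subset[OF that assms(2)] that
    proof (induction A rule: finite_induct)
      case (insert x F)
      then show ?case
        using sign[OF \<open>s \<in> carrier G\<close>, of x] by auto
    qed simp
    then show ?thesis
      by (simp add: \<mu>_def)
  qed
  fix s t assume st: "s \<in> carrier G" "t \<in> carrier G"
  have "c s t ^ Coset.order G * \<mu> (s \<otimes> t) = (\<Prod>u\<in>carrier G. c s t * c (s \<otimes> t) u)"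
    by (simp add: prod.distrib \<mu>_def Coset.order_def)
  also have "\<dots> = (\<Prod>u\<in>carrier G. c t u * c s (t \<otimes> u))"
    by (rule prod.cong) (auto simp: cocycle st)
  also have "\<dots> = \<mu> t * (\<Prod>u\<in>carrier G. c s (t \<otimes> u))"
    by (simp add: prod.distrib \<mu>_def)
  also have "(\<Prod>u\<in>carrier G. c s (t \<otimes> u)) = \<mu> s"
    unfolding \<mu>_def
    by (rule prod.reindex_bij_witness[of _ "\<lambda>u. inv t \<otimes> u" "\<lambda>u. t \<otimes> u"])
      (auto simp: st m_assoc[symmetric])
  finally have *: "c s t ^ Coset.order G * \<mu> (s \<otimes> t) = \<mu> t * \<mu> s" .
  have "c s t ^ Coset.order G = c s t"
    using sign[OF st] assms(3) by auto
  with * show "\<mu> s * \<mu> t * c s t = \<mu> (s \<otimes> t)"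
    using sign[OF st] by (auto simp: mult.commute)
qed

text \<open>Orthogonality of products forces the factors to be signs, associativity makes them a
  cocycle, and the splitting of sign cocycles in odd order supplies the rescaling
  \<open>\<mu>\<close>.\<close>

lemma projective_to_linear_representation:
  fixes G (structure) and R :: "'a \<Rightarrow> real mat"
  assumes "group G" "finite (carrier G)" "odd (Coset.order G)" "0 < d"
    and orth: "\<And>s. s \<in> carrier G \<Longrightarrow> real_orthogonal_mat d (R s)"
    and mult: "\<And>s t. s \<in> carrier G \<Longrightarrow> t \<in> carrier G \<Longrightarrow> \<exists>c. R s * R t = c \<cdot>\<^sub>m R (s \<otimes> t)"
  obtains \<mu> where "\<And>s. s \<in> carrier G \<Longrightarrow> \<mu> s \<in> {1, -1 :: real}"
    and "\<And>s t. s \<in> carrier G \<Longrightarrow> t \<in> carrier G \<Longrightarrow>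
      (\<mu> s \<cdot>\<^sub>m R s) * (\<mu> t \<cdot>\<^sub>m R t) = \<mu> (s \<otimes> t) \<cdot>\<^sub>m R (s \<otimes> t)"
proof -
  interpret group G by fact
  have car [simp]: "R s \<in> carrier_mat d d" if "s \<in> carrier G" for s
    using orth[OF that] by (simp add: real_orthogonal_mat_def)
  obtain c where c: "\<And>s t. s \<in> carrier G \<Longrightarrow> t \<in> carrier G \<Longrightarrow> R s * R t = c s t \<cdot>\<^sub>m R (s \<otimes> t)"
    using mult by metis
  have sign: "c s t \<in> {1, -1}" if st: "s \<in> carrier G" "t \<in> carrier G" for s t
  proof -
    have R1: "R x * (R x)\<^sup>T = 1\<^sub>m d" if "x \<in> carrier G" for x
      using orth[OF that] by (simp add: real_orthogonal_mat_def)
    have "(R s * R t) * (R s * R t)\<^sup>T = R s * (R t * ((R t)\<^sup>T * (R s)\<^sup>T))"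
      using st
      by (subst transpose_mult[of _ d d _ d]) (auto intro!: assoc_mult_mat[of _ d d _ d _ d] mult_carrier_mat[of _ d d])
    also have "R t * ((R t)\<^sup>T * (R s)\<^sup>T) = R t * (R t)\<^sup>T * (R s)\<^sup>T"
      using st by (simp add: assoc_mult_mat[of _ d d _ d _ d])
    also have "R s * (R t * (R t)\<^sup>T * (R s)\<^sup>T) = 1\<^sub>m d"
      using st by (simp add: R1 left_mult_one_mat[of _ d d])
    finally have "1\<^sub>m d = (c s t \<cdot>\<^sub>m R (s \<otimes> t)) * (c s t \<cdot>\<^sub>m R (s \<otimes> t))\<^sup>T"
      by (simp add: c st)
    also have "\<dots> = (c s t * c s t) \<cdot>\<^sub>m 1\<^sub>m d"
      using st by (simp add: transpose_smult_mat mult_smult_assoc_mat[of _ d d _ d]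
          mult_smult_distrib[of _ d d _ d] R1 smult_smult_mat)
    finally have "(1\<^sub>m d :: real mat) $$ (0, 0) = ((c s t * c s t) \<cdot>\<^sub>m 1\<^sub>m d) $$ (0, 0)"
      by simp
    then show ?thesis
      using \<open>0 < d\<close> by (simp add: square_eq_1_iff)
  qed
  have cocycle: "c s t * c (s \<otimes> t) u = c t u * c s (t \<otimes> u)"
    if stu: "s \<in> carrier G" "t \<in> carrier G" "u \<in> carrier G" for s t u
  proof (rule real_orthogonal_mat_smult_cancel[OF orth \<open>0 < d\<close>])
    have "(c s t * c (s \<otimes> t) u) \<cdot>\<^sub>m R (s \<otimes> t \<otimes> u) = (R s * R t) * R u"
      using stu by (simp add: c mult_smult_assoc_mat[of _ d d _ d] smult_smult_mat)
    also have "\<dots> = R s * (R t * R u)"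
      using stu by (intro assoc_mult_mat[of _ d d _ d _ d]) auto
    also have "\<dots> = (c t u * c s (t \<otimes> u)) \<cdot>\<^sub>m R (s \<otimes> t \<otimes> u)"
      using stu by (simp add: c mult_smult_distrib[of _ d d _ d] smult_smult_mat m_assoc)
    finally show "(c s t * c (s \<otimes> t) u) \<cdot>\<^sub>m R (s \<otimes> t \<otimes> u) =
      (c t u * c s (t \<otimes> u)) \<cdot>\<^sub>m R (s \<otimes> t \<otimes> u)" .
  qed (use stu in auto)
  obtain \<mu> where \<mu>: "\<And>s. s \<in> carrier G \<Longrightarrow> \<mu> s \<in> {1, -1}"
    and eq: "\<And>s t. s \<in> carrier G \<Longrightarrow> t \<in> carrier G \<Longrightarrow> \<mu> s * \<mu> t * c s t = \<mu> (s \<otimes> t)"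
    using sign_cocycle_odd_order[OF assms(1-3) sign cocycle] by blast
  show thesis
  proof (rule that[OF \<mu>])
    fix s t assume st: "s \<in> carrier G" "t \<in> carrier G"
    have "(\<mu> s \<cdot>\<^sub>m R s) * (\<mu> t \<cdot>\<^sub>m R t) = (\<mu> s * \<mu> t * c s t) \<cdot>\<^sub>m R (s \<otimes> t)"
      using st by (simp add: c mult_smult_assoc_mat[of _ d d _ d] mult_smult_distrib[of _ d d _ d]
          smult_smult_mat ac_simps)
    then show "(\<mu> s \<cdot>\<^sub>m R s) * (\<mu> t \<cdot>\<^sub>m R t) = \<mu> (s \<otimes> t) \<cdot>\<^sub>m R (s \<otimes> t)"
      by (simp add: eq st)
  qed
qed

text \<open>The inverse of an orthogonal matrix is its transpose, so the inner products of rows of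
  \<open>R s\<close> and \<open>R t\<close> are the entries of \<open>R (s \<otimes> inv t)\<close>,
  and \<open>s \<otimes> inv t\<close> is not the identity when \<open>s\<close> and
  \<open>t\<close> differ.\<close>

lemma defines_MUBs_if_flat_representation:
  fixes G (structure) and R :: "'a \<Rightarrow> real mat"
  assumes "group G" "0 < d"
    and orth: "\<And>s. s \<in> carrier G \<Longrightarrow> real_orthogonal_mat d (R s)"
    and mult: "\<And>s t. s \<in> carrier G \<Longrightarrow> t \<in> carrier G \<Longrightarrow> R s * R t = R (s \<otimes> t)"
    and flat: "\<And>s i j. s \<in> carrier G \<Longrightarrow> s \<noteq> \<one> \<Longrightarrow> i < d \<Longrightarrow> j < d \<Longrightarrow>
      (R s $$ (i, j))\<^sup>2 = 1 / real d"
  shows "real_representation G d R \<and> defines_MUBs G d R"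
proof
  interpret group G by fact
  have car [simp]: "R s \<in> carrier_mat d d" if "s \<in> carrier G" for s
    using orth[OF that] by (simp add: real_orthogonal_mat_def)
  have RT: "R s * (R s)\<^sup>T = 1\<^sub>m d" "(R s)\<^sup>T * R s = 1\<^sub>m d" if "s \<in> carrier G" for s
    using orth[OF that] by (simp_all add: real_orthogonal_mat_def)
  show "real_representation G d R"
    unfolding real_representation_def GL_real_def hom_def
    using mult RT
    by (auto simp: units_of_def Units_def ring_mat_def intro!: bexI[of _ "(R _)\<^sup>T"])
  \<comment> \<open>An invertible idempotent is the identity.\<close>
  have R1: "R \<one> = 1\<^sub>m d"
  proof -
    have "R \<one> = R \<one> * (R \<one> * (R \<one>)\<^sup>T)"
      using RT(1)[of \<one>] by (simp add: right_mult_one_mat[of _ d d])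
    also have "\<dots> = R \<one> * R \<one> * (R \<one>)\<^sup>T"
      by (simp add: assoc_mult_mat[of _ d d _ d _ d])
    also have "\<dots> = 1\<^sub>m d"
      by (simp add: mult RT)
    finally show ?thesis .
  qed
  have Rinv: "R (inv s) = (R s)\<^sup>T" if "s \<in> carrier G" for s
  proof -
    have "R (inv s) = R (inv s) * (R s * (R s)\<^sup>T)"
      using that by (simp add: RT right_mult_one_mat[of _ d d])
    also have "\<dots> = R (inv s) * R s * (R s)\<^sup>T"
      using that by (simp add: assoc_mult_mat[of _ d d _ d _ d])
    also have "\<dots> = (R s)\<^sup>T"
      using that by (simp add: mult R1 left_mult_one_mat[of _ d d])
    finally show ?thesis .
  qed
  show "defines_MUBs G d R"
    unfolding defines_MUBs_def mutually_unbiased_def basis_of_mat_def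
  proof (intro conjI ballI impI allI)
    fix s t i j assume st: "s \<in> carrier G" "t \<in> carrier G" "s \<noteq> t" and ij: "i < d" "j < d"
    have "row (R s) i \<bullet> row (R t) j = R (s \<otimes> inv t) $$ (i, j)"
      using st ij by (simp add: scalar_prod_rows_mult_transpose[of _ d] Rinv[symmetric] mult
          del: index_mult_mat)
    moreover have "s \<otimes> inv t \<noteq> \<one>"
      using st by (metis inv_equality inv_inv inv_closed)
    ultimately show "(row (R s) i \<bullet> row (R t) j)\<^sup>2 = 1 / real d"
      using st ij by (simp add: flat)
  qed (auto simp: orth orthonormal_basis_rows)
qed

section \<open>Lagrangian subspaces with disjoint translates\<close>

text \<open>Abstract data for the twisted group algebra: \<open>V\<close> is an elementary abelian
  2-group, \<open>\<beta>\<close> its bimultiplicative sign cocycle, and \<open>\<chi>\<close>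
  trivializes \<open>\<beta>\<close> on \<open>W\<close>. By \<open>maximal\<close>, whatever
  commutes with \<open>W\<close> lies in \<open>W\<close>; \<open>Y\<close> represents the cosets of
  \<open>W\<close>; \<open>disjoint\<close> and \<open>card_V\<close> make \<open>W\<close> and its
  nontrivial translates complementary.\<close>

locale lagrangian_orbit = group G for G :: "('g, 'm) monoid_scheme" (structure) +
  fixes V W Y :: "'s :: ab_group_add set" and \<beta> :: "'s \<Rightarrow> 's \<Rightarrow> real" and \<chi> :: "'s \<Rightarrow> real"
    and act :: "'g \<Rightarrow> 's \<Rightarrow> 's"
  assumes finite_V: "finite V"
    and double: "v + v = (0 :: 's)"
    and add_V: "u \<in> V \<Longrightarrow> v \<in> V \<Longrightarrow> u + v \<in> V"
    and W_sub: "W \<subseteq> V"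
    and zero_W: "0 \<in> W"
    and add_W: "u \<in> W \<Longrightarrow> v \<in> W \<Longrightarrow> u + v \<in> W"
    and Y_sub: "Y \<subseteq> V"
    and transversal: "v \<in> V \<Longrightarrow> \<exists>!y. y \<in> Y \<and> v + y \<in> W"
    and beta_square: "u \<in> V \<Longrightarrow> v \<in> V \<Longrightarrow> \<beta> u v * \<beta> u v = 1"
    and beta_add_left: "u \<in> V \<Longrightarrow> v \<in> V \<Longrightarrow> w \<in> V \<Longrightarrow> \<beta> (u + v) w = \<beta> u w * \<beta> v w"
    and beta_add_right: "u \<in> V \<Longrightarrow> v \<in> V \<Longrightarrow> w \<in> V \<Longrightarrow> \<beta> u (v + w) = \<beta> u v * \<beta> u w"
    and chi_square: "w \<in> W \<Longrightarrow> \<chi> w * \<chi> w = 1"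
    and chi_add: "u \<in> W \<Longrightarrow> w \<in> W \<Longrightarrow> \<chi> (u + w) = \<chi> u * \<chi> w * \<beta> u w"
    and act_V: "g \<in> carrier G \<Longrightarrow> v \<in> V \<Longrightarrow> act g v \<in> V"
    and act_add: "g \<in> carrier G \<Longrightarrow> u \<in> V \<Longrightarrow> v \<in> V \<Longrightarrow> act g (u + v) = act g u + act g v"
    and act_mult: "g \<in> carrier G \<Longrightarrow> h \<in> carrier G \<Longrightarrow> v \<in> V \<Longrightarrow> act (g \<otimes> h) v = act g (act h v)"
    and act_one: "v \<in> V \<Longrightarrow> act \<one> v = v"
    and beta_act: "g \<in> carrier G \<Longrightarrow> u \<in> V \<Longrightarrow> v \<in> V \<Longrightarrow> \<beta> (act g u) (act g v) = \<beta> u v"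
    and disjoint: "g \<in> carrier G \<Longrightarrow> g \<noteq> \<one> \<Longrightarrow> w \<in> W \<Longrightarrow> act g w \<in> W \<Longrightarrow> w = 0"
    and maximal: "s \<in> V \<Longrightarrow> (\<And>w. w \<in> W \<Longrightarrow> \<beta> w s = \<beta> s w) \<Longrightarrow> s \<in> W"
    and card_V: "card V = card W * card W"
begin

declare double [simp]

lemma add_self_cancel [simp]: "u + (u + v) = (v :: 's)" "u + (v + u) = v" "v + u + u = v"
  by (simp flip: add.assoc, simp_all add: add.commute[of u] add.assoc)

lemma transversal_unique: "v \<in> V \<Longrightarrow> y \<in> Y \<Longrightarrow> z \<in> Y \<Longrightarrow> v + y \<in> W \<Longrightarrow> v + z \<in> W \<Longrightarrow> y = z"
  using transversal by blast

lemma zero_V: "0 \<in> V"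
  using W_sub zero_W by auto

lemma W_V: "w \<in> W \<Longrightarrow> w \<in> V"
  using W_sub by auto

lemma Y_V: "y \<in> Y \<Longrightarrow> y \<in> V"
  using Y_sub by auto

lemma finite_W: "finite W" and finite_Y: "finite Y"
  using finite_V W_sub Y_sub finite_subset by blast+

lemma card_W_pos: "0 < card W"
  using finite_W zero_W by (auto simp: card_gt_0_iff)

lemma beta_cases: "u \<in> V \<Longrightarrow> v \<in> V \<Longrightarrow> \<beta> u v \<in> {1, -1}"
  using beta_square[of u v] by (simp add: square_eq_1_iff)

lemma chi_cases: "w \<in> W \<Longrightarrow> \<chi> w \<in> {1, -1}"
  using chi_square[of w] by (simp add: square_eq_1_iff)

lemma beta_zero: "u \<in> V \<Longrightarrow> \<beta> u 0 = 1" "u \<in> V \<Longrightarrow> \<beta> 0 u = 1"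
  using beta_add_right[of u 0 0] beta_add_left[of 0 0 u] beta_cases[of u 0] beta_cases[of 0 u] zero_V
  by auto

lemma chi_zero: "\<chi> 0 = 1"
  using chi_add[of 0 0] chi_cases[of 0] zero_W beta_zero[of 0] zero_V by auto

lemma act_zero: "g \<in> carrier G \<Longrightarrow> act g 0 = 0"
  using act_add[of g 0 0] zero_V by (metis add_cancel_left_left)

lemma act_inv_left: "g \<in> carrier G \<Longrightarrow> v \<in> V \<Longrightarrow> act (inv g) (act g v) = v"
  using act_mult[of "inv g" g v] act_one by simp

lemma act_inv_right: "g \<in> carrier G \<Longrightarrow> v \<in> V \<Longrightarrow> act g (act (inv g) v) = v"
  using act_mult[of g "inv g" v] act_one by simp

lemma sum_V_act:
  assumes "g \<in> carrier G"
  shows "(\<Sum>v\<in>V. f (act g v)) = (\<Sum>v\<in>V. f v :: real)"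
  by (rule sum.reindex_bij_witness[of _ "act (inv g)" "act g"])
    (use assms in \<open>auto simp: act_inv_left act_inv_right act_V\<close>)

lemma sum_V_translate:
  assumes "w \<in> V"
  shows "(\<Sum>v\<in>V. f (v + w)) = (\<Sum>v\<in>V. f v :: real)"
  by (rule sum.reindex_bij_witness[of _ "\<lambda>v. v + w" "\<lambda>v. v + w"])
    (use assms in \<open>auto simp: add_V\<close>)

lemma card_Y: "card Y = card W"
proof -
  have "bij_betw (\<lambda>(y, w). y + w) (Y \<times> W) V"
  proof (rule bij_betwI')
    fix p q assume "p \<in> Y \<times> W" "q \<in> Y \<times> W"
    then obtain y w y' w' where pq: "p = (y, w)" "q = (y', w')" "y \<in> Y" "w \<in> W" "y' \<in> Y" "w' \<in> W"
      by auto
    have "y = y' \<and> w = w'" if "y + w = y' + w'"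
    proof -
      have "(y + w) + y \<in> W"
        using pq by (simp add: add.commute[of "y + w" y])
      moreover have "(y + w) + y' \<in> W"
        unfolding that using pq by (simp add: add.commute[of "y' + w'" y'])
      ultimately have "y = y'"
        using pq(3-6) by (intro transversal_unique[of "y + w" y y']) (simp_all add: add_V Y_V W_V)
      then show ?thesis
        using that by simp
    qed
    then show "((case p of (y, w) \<Rightarrow> y + w) = (case q of (y, w) \<Rightarrow> y + w)) = (p = q)"
      using pq by auto
  next
    fix v assume "v \<in> V"
    then obtain y where "y \<in> Y" "v + y \<in> W"
      using transversal by blast
    then show "\<exists>p\<in>Y \<times> W. v = (case p of (y, w) \<Rightarrow> y + w)"
      by (intro bexI[of _ "(y, v + y)"]) (auto simp: ac_simps)
  qed (auto simp: add_V Y_V W_V)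
  then have "card Y * card W = card W * card W"
    using card_V by (simp add: bij_betw_same_card card_cartesian_product[symmetric])
  then show ?thesis
    using card_W_pos by simp
qed

text \<open>If two such sums agree, the difference of their second summands lies in \<open>W\<close>
  and in its translate, hence is 0. The map from \<open>W \<times> W\<close> is therefore injective,
  and \<open>card_V\<close> makes it onto.\<close>

lemma complement_orbit:
  assumes "g \<in> carrier G" "g \<noteq> \<one>" "s \<in> V"
  shows "\<exists>!p. p \<in> W \<times> W \<and> s = fst p + act g (snd p)"
proof -
  let ?f = "\<lambda>p. fst p + act g (snd p)"
  have inj: "inj_on ?f (W \<times> W)"
  proof (rule inj_onI)
    fix p q assume pq: "p \<in> W \<times> W" "q \<in> W \<times> W" "?f p = ?f q"
    then have eq: "fst p + act g (snd p) = fst q + act g (snd q)"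
      by simp
    have "act g (snd p + snd q) = fst p + (fst p + act g (snd p)) + act g (snd q)"
      using pq(1,2) assms by (auto simp: act_add W_V)
    also have "\<dots> = fst p + fst q"
      unfolding eq by (simp add: add.assoc)
    finally have "act g (snd p + snd q) = fst p + fst q" .
    moreover have "snd p + snd q \<in> W" "fst p + fst q \<in> W"
      using pq by (auto intro: add_W)
    ultimately have "snd p + snd q = 0"
      using disjoint[OF assms(1,2)] by simp
    then have "snd p = snd q"
      using add_self_cancel(3)[of "snd p" "snd q"] by simp
    then show "p = q"
      using pq(3) by (simp add: prod_eq_iff)
  qed
  have "?f ` (W \<times> W) = V"
  proof (rule card_subset_eq)
    show "?f ` (W \<times> W) \<subseteq> V"
      using assms by (auto simp: add_V act_V W_V)
    show "card (?f ` (W \<times> W)) = card V"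
      by (simp add: card_image[OF inj] card_V card_cartesian_product)
  qed (rule finite_V)
  then have "bij_betw ?f (W \<times> W) V"
    using inj by (simp add: bij_betw_def)
  then obtain p where "p \<in> W \<times> W" "s = ?f p"
    using assms(3) by (auto simp: bij_betw_def)
  with inj show ?thesis
    by (intro ex1I[of _ p]) (auto simp only: inj_on_def)
qed

section \<open>Equivariant functions and their translates\<close>

text \<open>The function supported on the coset of \<open>y\<close>, equal to 1 at \<open>y\<close>,
  and equivariant under \<open>W\<close> in the sense of \<open>wave_translate\<close>. For
  \<open>y\<close> in \<open>Y\<close> these functions are orthogonal, see
  \<open>gram_one\<close>.\<close>

definition wave :: "'s \<Rightarrow> 's \<Rightarrow> real" where
  "wave y v = (if v + y \<in> W then \<chi> (v + y) * \<beta> y (v + y) else 0)"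

text \<open>Inner products of waves with waves translated by \<open>g\<close>; up to normalization,
  these are the matrix entries of the projective representation.\<close>

definition gram :: "'g \<Rightarrow> 's \<Rightarrow> 's \<Rightarrow> real" where
  "gram g x y = (\<Sum>v\<in>V. wave x v * wave y (act (inv g) v))"

lemma wave_cases: "y \<in> Y \<Longrightarrow> v + y \<in> W \<Longrightarrow> wave y v \<in> {1, -1}"
  using chi_cases[of "v + y"] beta_cases[of y "v + y"] by (auto simp: wave_def Y_V W_V)

lemma wave_square: "y \<in> Y \<Longrightarrow> wave y v * wave y v = of_bool (v + y \<in> W)"
  using wave_cases[of y v] by (auto simp: wave_def)

lemma add_W_iff: "w \<in> W \<Longrightarrow> v + w \<in> W \<longleftrightarrow> v \<in> W"
  using add_W by (metis add_self_cancel(3))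

lemma wave_translate:
  assumes y: "y \<in> Y" and v: "v \<in> V" and w: "w \<in> W"
  shows "wave y (v + w) = \<chi> w * \<beta> v w * wave y v"
proof (cases "v + y \<in> W")
  case True
  note V = Y_V[OF y] v W_V[OF w] W_V[OF True]
  have "wave y (v + w) = \<chi> ((v + y) + w) * \<beta> y ((v + y) + w)"
    using add_W[OF True w] by (simp add: wave_def ac_simps)
  also have "\<dots> = \<chi> w * \<beta> v w * (\<chi> (v + y) * \<beta> y (v + y)) * (\<beta> y w * \<beta> y w)"
    unfolding chi_add[OF True w] beta_add_right[OF V(1,4,3)] beta_add_left[OF V(2,1,3)]
    by (simp add: ac_simps)
  also have "\<dots> = \<chi> w * \<beta> v w * wave y v"
    using True V by (simp add: beta_square wave_def)
  finally show ?thesis .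
next
  case False
  then have "v + w + y \<notin> W"
    using add_W_iff[OF w, of "v + y"] by (simp add: ac_simps)
  then show ?thesis
    using False by (simp add: wave_def)
qed

text \<open>Expanding \<open>f\<close> in the orthogonal waves and summing its twisted translates
  over \<open>W\<close> both give \<open>card W\<close> times the orthogonal projection onto
  equivariant functions. The kernel vanishes unless \<open>u\<close> and \<open>v\<close> share a
  coset, and then exactly one representative contributes.\<close>

lemma wave_projection:
  fixes f :: "'s \<Rightarrow> real"
  assumes u: "u \<in> V"
  shows "(\<Sum>v\<in>V. (\<Sum>y\<in>Y. wave y u * wave y v) * f v) = (\<Sum>w\<in>W. \<chi> w * \<beta> u w * f (u + w))"
proof -
  have kernel: "(\<Sum>y\<in>Y. wave y u * wave y v) =
    (if u + v \<in> W then \<chi> (u + v) * \<beta> u (u + v) else 0)" if v: "v \<in> V" for v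
  proof (cases "u + v \<in> W")
    case True
    have "(\<Sum>y\<in>Y. wave y u * wave y v) = (\<Sum>y\<in>Y. \<chi> (u + v) * \<beta> u (u + v) * of_bool (u + y \<in> W))"
    proof (rule sum.cong)
      fix y assume y: "y \<in> Y"
      have "wave y v = \<chi> (u + v) * \<beta> u (u + v) * wave y u"
        using wave_translate[OF y u True] by simp
      then show "wave y u * wave y v = \<chi> (u + v) * \<beta> u (u + v) * of_bool (u + y \<in> W)"
        using wave_square[OF y, of u] by (metis mult.assoc mult.commute)
    qed simp
    also have "(\<Sum>y\<in>Y. \<chi> (u + v) * \<beta> u (u + v) * of_bool (u + y \<in> W)) = \<chi> (u + v) * \<beta> u (u + v)"
    proof -
      obtain y0 where y0: "y0 \<in> Y" "u + y0 \<in> W" "\<And>y. y \<in> Y \<Longrightarrow> u + y \<in> W \<Longrightarrow> y = y0"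
        using transversal[OF u] by blast
      have "(\<Sum>y\<in>Y. of_bool (u + y \<in> W) :: real) = (\<Sum>y\<in>Y. if y = y0 then 1 else 0)"
      proof (rule sum.cong)
        fix y assume "y \<in> Y"
        then show "(of_bool (u + y \<in> W) :: real) = (if y = y0 then 1 else 0)"
          using y0(2,3) by (metis of_bool_eq)
      qed simp
      also have "\<dots> = 1"
        using y0(1) finite_Y by simp
      finally show ?thesis
        by (simp only: sum_distrib_left[symmetric] mult_1_right)
    qed
    finally show ?thesis
      using True by simp
  next
    case False
    have "wave y u * wave y v = 0" for y
    proof (rule ccontr)
      assume "wave y u * wave y v \<noteq> 0"
      then have "(u + y) + (v + y) \<in> W"
        by (intro add_W[of "u + y"]) (auto simp: wave_def split: if_splits)
      moreover have "(u + y) + (v + y) = u + v"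
        by (simp add: ac_simps)
      ultimately show False
        using False by simp
    qed
    then have "(\<Sum>y\<in>Y. wave y u * wave y v) = 0"
      by (intro sum.neutral) blast
    then show ?thesis
      using False by simp
  qed
  have "(\<Sum>v\<in>V. (\<Sum>y\<in>Y. wave y u * wave y v) * f v) =
    (\<Sum>v\<in>V. (if u + v \<in> W then \<chi> (u + v) * \<beta> u (u + v) else 0) * f v)"
    by (rule sum.cong) (simp_all add: kernel)
  also have "\<dots> = (\<Sum>v\<in>V. (if v \<in> W then \<chi> v * \<beta> u v else 0) * f (v + u))"
    using sum_V_translate[OF u, of "\<lambda>v. (if u + v \<in> W then \<chi> (u + v) * \<beta> u (u + v) else 0) * f v"]
    by (simp add: ac_simps cong: if_cong)
  also have "\<dots> = (\<Sum>v\<in>W. (if v \<in> W then \<chi> v * \<beta> u v else 0) * f (v + u))"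
    by (rule sum.mono_neutral_right) (auto simp: finite_V W_V)
  finally show ?thesis
    by (simp add: add.commute)
qed

text \<open>The element \<open>s\<close> of the twisted group algebra acts by
  \<open>f \<mapsto> (\<lambda>u. \<beta> u s * f (u + s))\<close>; here it is applied to the
  translate of \<open>wave y\<close> by \<open>g\<close> and paired with
  \<open>wave x\<close>.\<close>

definition twisted_gram :: "'g \<Rightarrow> 's \<Rightarrow> 's \<Rightarrow> 's \<Rightarrow> real" where
  "twisted_gram g s x y = (\<Sum>u\<in>V. wave x u * \<beta> u s * wave y (act (inv g) (u + s)))"

lemma twisted_gram_zero: "g \<in> carrier G \<Longrightarrow> twisted_gram g 0 x y = gram g x y"
  unfolding twisted_gram_def gram_def by (rule sum.cong) (simp_all add: beta_zero)

text \<open>Summing over \<open>z\<close> inserts the projection of \<open>wave_projection\<close>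
  between two translations. Moving its sum over \<open>W\<close> past \<open>g\<close> replaces
  \<open>w\<close> by \<open>act g w\<close>, by invariance of \<open>\<beta>\<close>.\<close>

lemma gram_product:
  assumes g: "g \<in> carrier G" and h: "h \<in> carrier G"
  shows "(\<Sum>z\<in>Y. gram g x z * gram h z y) = (\<Sum>w\<in>W. \<chi> w * twisted_gram (g \<otimes> h) (act g w) x y)"
proof -
  define f where "f v = wave y (act (inv h) v)" for v
  have "(\<Sum>z\<in>Y. gram g x z * gram h z y) =
    (\<Sum>z\<in>Y. \<Sum>u\<in>V. \<Sum>v\<in>V. wave x u * wave z (act (inv g) u) * (wave z v * f v))"
    by (simp add: gram_def f_def sum_product)
  also have "\<dots> = (\<Sum>u\<in>V. \<Sum>z\<in>Y. \<Sum>v\<in>V. wave x u * wave z (act (inv g) u) * (wave z v * f v))"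
    by (rule sum.swap)
  also have "\<dots> = (\<Sum>u\<in>V. \<Sum>v\<in>V. \<Sum>z\<in>Y. wave x u * wave z (act (inv g) u) * (wave z v * f v))"
    by (intro sum.cong refl sum.swap)
  also have "\<dots> = (\<Sum>u\<in>V. wave x u * (\<Sum>v\<in>V. (\<Sum>z\<in>Y. wave z (act (inv g) u) * wave z v) * f v))"
    by (simp add: sum_distrib_left sum_distrib_right ac_simps)
  also have "\<dots> = (\<Sum>u\<in>V. wave x u * (\<Sum>w\<in>W. \<chi> w * \<beta> (act (inv g) u) w * f (act (inv g) u + w)))"
    using g by (intro sum.cong refl arg_cong[where f = "\<lambda>t. _ * t"] wave_projection) (auto simp: act_V)
  also have "\<dots> = (\<Sum>u\<in>V. \<Sum>w\<in>W. \<chi> w * (wave x u * \<beta> u (act g w) *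
      wave y (act (inv (g \<otimes> h)) (u + act g w))))"
    unfolding sum_distrib_left
  proof (intro sum.cong refl)
    fix u w assume u: "u \<in> V" and w: "w \<in> W"
    have "\<beta> (act (inv g) u) w = \<beta> u (act g w)"
      using beta_act[OF g, of "act (inv g) u" w] g u w by (simp add: act_inv_right act_V W_V)
    moreover have "act (inv (g \<otimes> h)) (u + act g w) = act (inv h) (act (inv g) u + w)"
      using g h u w
      by (simp add: inv_mult_group act_mult act_V add_V W_V act_add act_inv_left)
    ultimately show "wave x u * (\<chi> w * \<beta> (act (inv g) u) w * f (act (inv g) u + w)) =
      \<chi> w * (wave x u * \<beta> u (act g w) * wave y (act (inv (g \<otimes> h)) (u + act g w)))"
      by (simp add: f_def)
  qed
  also have "\<dots> = (\<Sum>w\<in>W. \<chi> w * twisted_gram (g \<otimes> h) (act g w) x y)"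
    unfolding twisted_gram_def sum_distrib_left by (rule sum.swap)
  finally show ?thesis .
qed

text \<open>
  Writing \<open>s = w\<^sub>1 + g w\<^sub>2\<close> with \<open>w\<^sub>1, w\<^sub>2 \<in> W\<close>, the first summand is absorbed by the left
  wave and the second one by the right wave.
\<close>

lemma twisted_gram_scalar:
  assumes g: "g \<in> carrier G" "g \<noteq> \<one>" and s: "s \<in> V"
  shows "\<exists>c. \<forall>x\<in>Y. \<forall>y\<in>Y. twisted_gram g s x y = c * gram g x y"
proof -
  obtain w1 w2 where w: "w1 \<in> W" "w2 \<in> W" and s_eq: "s = w1 + act g w2"
    using complement_orbit[OF g s] by (metis mem_Times_iff)
  define a where "a = act g w2"
  have V: "w1 \<in> V" "w2 \<in> V" "a \<in> V"
    using w g by (auto simp: a_def W_V act_V)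
  have "twisted_gram g s x y = (\<chi> w1 * \<chi> w2 * \<beta> w1 s) * gram g x y" if xy: "x \<in> Y" "y \<in> Y" for x y
  proof -
    have "twisted_gram g s x y =
      (\<Sum>u\<in>V. wave x (u + w1) * \<beta> (u + w1) s * wave y (act (inv g) (u + w1 + s)))"
      unfolding twisted_gram_def by (rule sum_V_translate[OF V(1), symmetric])
    also have "\<dots> = (\<Sum>u\<in>V. (\<chi> w1 * \<chi> w2 * \<beta> w1 s) * (wave x u * wave y (act (inv g) u)))"
    proof (rule sum.cong)
      fix u assume u: "u \<in> V"
      have 1: "u + w1 + s = u + a"
        by (simp add: s_eq a_def add.assoc)
      have "wave y (act (inv g) (u + a)) = wave y (act (inv g) u + w2)"
        using u g V by (simp add: act_add a_def act_inv_left)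
      also have "\<dots> = \<chi> w2 * \<beta> (act (inv g) u) w2 * wave y (act (inv g) u)"
        using u g w xy by (intro wave_translate) (auto simp: act_V)
      also have "\<beta> (act (inv g) u) w2 = \<beta> u a"
        using beta_act[OF g(1), of "act (inv g) u" w2] g u V by (simp add: act_inv_right act_V a_def)
      finally have 2: "wave y (act (inv g) (u + a)) = \<chi> w2 * \<beta> u a * wave y (act (inv g) u)" .
      have 3: "\<beta> (u + w1) s = \<beta> u w1 * \<beta> u a * \<beta> w1 s"
        using u V s by (simp add: beta_add_left s_eq beta_add_right flip: a_def)
      have 4: "\<beta> u w1 * \<beta> u w1 = 1" "\<beta> u a * \<beta> u a = 1"
        using u V by (auto intro: beta_square)
      have "wave x (u + w1) * \<beta> (u + w1) s * wave y (act (inv g) (u + w1 + s)) =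
        (\<beta> u w1 * \<beta> u w1) * (\<beta> u a * \<beta> u a) *
        ((\<chi> w1 * \<chi> w2 * \<beta> w1 s) * (wave x u * wave y (act (inv g) u)))"
        unfolding 1 2 3 wave_translate[OF xy(1) u w(1)] by (simp only: ac_simps)
      then show "wave x (u + w1) * \<beta> (u + w1) s * wave y (act (inv g) (u + w1 + s)) =
        (\<chi> w1 * \<chi> w2 * \<beta> w1 s) * (wave x u * wave y (act (inv g) u))"
        by (simp add: 4)
    qed simp
    also have "\<dots> = (\<chi> w1 * \<chi> w2 * \<beta> w1 s) * gram g x y"
      by (simp add: gram_def sum_distrib_left)
    finally show ?thesis .
  qed
  then show ?thesis
    by blast
qed

text \<open>Some \<open>w\<close> in \<open>W\<close> anticommutes with \<open>s\<close>. Shifting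
  the summation variable by \<open>w\<close> reverses the sign of every term, so the sum equals its
  own negative.\<close>

lemma twisted_gram_one:
  assumes s: "s \<in> V" "s \<notin> W" and xy: "x \<in> Y" "y \<in> Y"
  shows "twisted_gram \<one> s x y = 0"
proof -
  obtain w where w: "w \<in> W" "\<beta> w s \<noteq> \<beta> s w"
    using maximal[OF s(1)] s(2) by blast
  have anti: "\<beta> w s * \<beta> s w = -1"
    using w s beta_cases[of w s] beta_cases[of s w] by (auto simp: W_V)
  have eq: "twisted_gram \<one> s x y = (\<Sum>u\<in>V. wave x u * \<beta> u s * wave y (u + s))"
    unfolding twisted_gram_def by (rule sum.cong) (use s in \<open>auto simp: act_one add_V\<close>)
  also have "\<dots> = (\<Sum>u\<in>V. wave x (u + w) * \<beta> (u + w) s * wave y (u + w + s))"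
    by (rule sum_V_translate[OF W_V[OF w(1)], symmetric])
  also have "\<dots> = (\<Sum>u\<in>V. - (wave x u * \<beta> u s * wave y (u + s)))"
  proof (rule sum.cong)
    fix u assume u: "u \<in> V"
    have 1: "wave y (u + w + s) = \<chi> w * (\<beta> u w * \<beta> s w) * wave y (u + s)"
      using wave_translate[OF xy(2) add_V[OF u s(1)] w(1)] u s w
      by (simp add: ac_simps beta_add_left W_V)
    have 2: "\<beta> (u + w) s = \<beta> u s * \<beta> w s"
      using u w s by (simp add: beta_add_left W_V)
    have "wave x (u + w) * \<beta> (u + w) s * wave y (u + w + s) =
      (\<chi> w * \<chi> w) * (\<beta> u w * \<beta> u w) * (\<beta> w s * \<beta> s w) * (wave x u * \<beta> u s * wave y (u + s))"
      unfolding 1 2 wave_translate[OF xy(1) u w(1)] by (simp only: ac_simps)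
    then show "wave x (u + w) * \<beta> (u + w) s * wave y (u + w + s) =
      - (wave x u * \<beta> u s * wave y (u + s))"
      using u w by (simp add: chi_square beta_square W_V anti)
  qed simp
  also have "\<dots> = - twisted_gram \<one> s x y"
    by (simp add: eq sum_negf)
  finally show ?thesis
    by simp
qed

lemma gram_one:
  assumes xy: "x \<in> Y" "y \<in> Y"
  shows "gram \<one> x y = (if x = y then real (card W) else 0)"
proof -
  have eq: "gram \<one> x y = (\<Sum>v\<in>V. wave x v * wave y v)"
    unfolding gram_def by (rule sum.cong) (auto simp: act_one)
  show ?thesis
  proof (cases "x = y")
    case True
    have "gram \<one> x y = (\<Sum>v\<in>V. of_bool (v + x \<in> W))"
      unfolding eq unfolding True[symmetric] by (simp add: wave_square[OF xy(1)])
    also have "\<dots> = (\<Sum>v\<in>V. of_bool (v \<in> W))"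
      using sum_V_translate[OF Y_V[OF xy(1)], of "\<lambda>v. of_bool (v \<in> W)"] by simp
    also have "\<dots> = real (card (V \<inter> W))"
      using finite_V by simp
    also have "V \<inter> W = W"
      using W_sub by blast
    finally show ?thesis
      using True by simp
  next
    case False
    have "wave x v * wave y v = 0" if "v \<in> V" for v
      using transversal_unique[OF that xy] False by (auto simp: wave_def)
    then have "gram \<one> x y = 0"
      unfolding eq by (intro sum.neutral) blast
    then show ?thesis
      using False by simp
  qed
qed

text \<open>In \<open>gram_product\<close> only \<open>w = 0\<close> survives: every other
  \<open>act g w\<close> lies outside \<open>W\<close>, where \<open>twisted_gram_one\<close>
  applies. This gives orthogonality of the normalized matrices.\<close>

lemma gram_mult_inverse:
  assumes g: "g \<in> carrier G" "g \<noteq> \<one>" and h: "h \<in> carrier G" "g \<otimes> h = \<one>"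
    and xy: "x \<in> Y" "y \<in> Y"
  shows "(\<Sum>z\<in>Y. gram g x z * gram h z y) = (if x = y then real (card W) else 0)"
proof -
  have "(\<Sum>z\<in>Y. gram g x z * gram h z y) = (\<Sum>w\<in>W. \<chi> w * twisted_gram \<one> (act g w) x y)"
    by (simp add: gram_product[OF g(1) h(1)] h)
  also have "\<dots> = (\<Sum>w\<in>{0}. \<chi> w * twisted_gram \<one> (act g w) x y)"
  proof (rule sum.mono_neutral_right)
    show "\<forall>w\<in>W - {0}. \<chi> w * twisted_gram \<one> (act g w) x y = 0"
    proof
      fix w assume w: "w \<in> W - {0}"
      then have "act g w \<notin> W" "act g w \<in> V"
        using disjoint[OF g] g by (auto simp: W_V act_V)
      then show "\<chi> w * twisted_gram \<one> (act g w) x y = 0"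
        using xy by (simp add: twisted_gram_one)
    qed
  qed (auto simp: finite_W zero_W)
  also have "\<dots> = gram \<one> x y"
    using g by (simp add: act_zero chi_zero twisted_gram_zero)
  finally show ?thesis
    using xy by (simp add: gram_one)
qed

text \<open>Each term of \<open>gram_product\<close> is a multiple of the same matrix by
  \<open>twisted_gram_scalar\<close>, with a factor that depends on \<open>w\<close> but not on
  \<open>x\<close> and \<open>y\<close>.\<close>

lemma gram_mult:
  assumes g: "g \<in> carrier G" and h: "h \<in> carrier G" "g \<otimes> h \<noteq> \<one>"
  shows "\<exists>c. \<forall>x\<in>Y. \<forall>y\<in>Y. (\<Sum>z\<in>Y. gram g x z * gram h z y) = c * gram (g \<otimes> h) x y"
proof -
  have "\<forall>w\<in>W. \<exists>c. \<forall>x\<in>Y. \<forall>y\<in>Y. twisted_gram (g \<otimes> h) (act g w) x y = c * gram (g \<otimes> h) x y"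
    using g h by (auto intro!: twisted_gram_scalar simp: act_V W_V)
  then obtain c where c: "\<And>w x y. w \<in> W \<Longrightarrow> x \<in> Y \<Longrightarrow> y \<in> Y \<Longrightarrow>
      twisted_gram (g \<otimes> h) (act g w) x y = c w * gram (g \<otimes> h) x y"
    by metis
  have "(\<Sum>z\<in>Y. gram g x z * gram h z y) = (\<Sum>w\<in>W. \<chi> w * c w) * gram (g \<otimes> h) x y"
    if "x \<in> Y" "y \<in> Y" for x y
    using that by (simp add: gram_product[OF g h(1)] c sum_distrib_right mult.assoc)
  then show ?thesis
    by blast
qed

lemma gram_inv:
  assumes "g \<in> carrier G"
  shows "gram (inv g) x y = gram g y x"
proof -
  have "gram (inv g) x y = (\<Sum>v\<in>V. wave x (act (inv g) v) * wave y (act g (act (inv g) v)))"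
    using assms sum_V_act[of "inv g" "\<lambda>v. wave x v * wave y (act g v)"] by (simp add: gram_def)
  also have "\<dots> = gram g y x"
    unfolding gram_def by (rule sum.cong) (use assms in \<open>auto simp: act_inv_right\<close>)
  finally show ?thesis .
qed

text \<open>The supports of the two waves, one coset of \<open>W\<close> and one of its translate,
  meet in a single point, so the sum has one nonzero term, a sign.\<close>

lemma gram_square:
  assumes g: "g \<in> carrier G" "g \<noteq> \<one>" and xy: "x \<in> Y" "y \<in> Y"
  shows "gram g x y * gram g x y = 1"
proof -
  have "x + act g y \<in> V"
    using xy g by (simp add: add_V act_V Y_V)
  from complement_orbit[OF g this] obtain p where p: "p \<in> W \<times> W" "x + act g y = fst p + act g (snd p)"
    and p_unique: "\<And>q. q \<in> W \<times> W \<Longrightarrow> x + act g y = fst q + act g (snd q) \<Longrightarrow> q = p"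
    by blast
  define w1 w2 where "w1 = fst p" and "w2 = snd p"
  have w: "w1 \<in> W" "w2 \<in> W" and eq: "x + act g y = w1 + act g w2"
    using p by (auto simp: w1_def w2_def)
  have unique: "u = w1" if "u \<in> W" "w \<in> W" "x + act g y = u + act g w" for u w
    using p_unique[of "(u, w)"] that by (auto simp: w1_def)
  \<comment> \<open>The common point of both supports: \<open>x + w1\<close> equals
    \<open>act g (y + w2)\<close>.\<close>
  define v0 where "v0 = x + w1"
  have v0: "v0 \<in> V" "v0 + x \<in> W"
    using w xy by (auto simp: v0_def add_V Y_V W_V ac_simps)
  have "v0 = (x + act g y) + act g y + w1"
    by (simp add: v0_def)
  also have "\<dots> = act g (y + w2)"
    unfolding eq using w xy g by (simp add: act_add Y_V W_V ac_simps)
  finally have "v0 = act g (y + w2)" .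
  then have inv_v0: "act (inv g) v0 = y + w2"
    using w xy g by (simp add: act_inv_left add_V Y_V W_V)
  have zero: "wave x v * wave y (act (inv g) v) = 0" if v: "v \<in> V" "v \<noteq> v0" for v
  proof (rule ccontr)
    assume "wave x v * wave y (act (inv g) v) \<noteq> 0"
    then have W: "v + x \<in> W" "act (inv g) v + y \<in> W"
      by (auto simp: wave_def split: if_splits)
    have "act g (act (inv g) v + y) = v + act g y"
      using g v xy by (simp add: act_add act_V Y_V act_inv_right)
    then have "x + act g y = (v + x) + act g (act (inv g) v + y)"
      by (simp add: ac_simps)
    then have "v + x = w1"
      using unique W by blast
    then show False
      using v by (auto simp: v0_def ac_simps)
  qed
  have "gram g x y = (\<Sum>v\<in>{v0}. wave x v * wave y (act (inv g) v))"
    unfolding gram_def by (rule sum.mono_neutral_right) (use zero v0 finite_V in auto)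
  then have "gram g x y = wave x v0 * wave y (act (inv g) v0)"
    by simp
  moreover have "act (inv g) v0 + y \<in> W"
    using w by (simp add: inv_v0 ac_simps)
  ultimately show ?thesis
    using wave_cases[OF xy(1) v0(2)] wave_cases[OF xy(2), of "act (inv g) v0"] by auto
qed

section \<open>The flat orthogonal representation\<close>

lemma flat_representation_exists:
  assumes "finite (carrier G)" "odd (Coset.order G)"
  shows "\<exists>R. real_representation G (card W) R \<and> defines_MUBs G (card W) R"
proof -
  define d where "d = card W"
  have d: "0 < d"
    using card_W_pos by (simp add: d_def)
  obtain y where y: "bij_betw y {..<d} Y"
    using ex_bij_betw_nat_finite[OF finite_Y] by (auto simp: card_Y d_def atLeast0LessThan)
  have y_Y [simp]: "y i \<in> Y" if "i < d" for i
    using y that by (auto simp: bij_betw_def)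
  have y_eq: "y i = y j \<longleftrightarrow> i = j" if "i < d" "j < d" for i j
    using y that by (auto simp: bij_betw_def inj_on_def)
  \<comment> \<open>At the identity \<open>gram\<close> is already diagonal with entries
    \<open>d\<close>, so division by \<open>sqrt d\<close> would not normalize it; this case is set
    apart.\<close>
  define R where "R g = mat d d (\<lambda>(i, j). if g = \<one> then of_bool (i = j)
    else gram g (y i) (y j) / sqrt (real d))" for g
  have R_carrier [simp]: "R g \<in> carrier_mat d d" for g
    by (simp add: R_def)
  have R_dim [simp]: "dim_row (R g) = d" "dim_col (R g) = d" for g
    by (simp_all add: R_def)
  have R_one: "R \<one> = 1\<^sub>m d"
    by (intro eq_matI) (auto simp: R_def)
  have R_smult: "(1 :: real) \<cdot>\<^sub>m A = A" for A
    by (intro eq_matI) auto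
  have R_inv: "R (inv g) = (R g)\<^sup>T" if g: "g \<in> carrier G" for g
  proof -
    have "inv g = \<one> \<longleftrightarrow> g = \<one>"
      using g inv_inv by fastforce
    then show ?thesis
      by (intro eq_matI) (auto simp: R_def gram_inv g)
  qed
  have entry: "(R g * R h) $$ (i, j) = (\<Sum>z\<in>Y. gram g (y i) z * gram h z (y j)) / real d"
    if "g \<noteq> \<one>" "h \<noteq> \<one>" "i < d" "j < d" for g h i j
  proof -
    have "(R g * R h) $$ (i, j) = (\<Sum>l<d. gram g (y i) (y l) * gram h (y l) (y j) / real d)"
      using that by (simp add: scalar_prod_def R_def atLeast0LessThan)
    also have "\<dots> = (\<Sum>z\<in>Y. gram g (y i) z * gram h z (y j) / real d)"
      by (rule sum.reindex_bij_betw[OF y])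
    finally show ?thesis
      by (simp add: sum_divide_distrib)
  qed
  have R_mult_inv: "R g * R h = 1\<^sub>m d"
    if g: "g \<in> carrier G" "h \<in> carrier G" "g \<otimes> h = \<one>" for g h
  proof (cases "g = \<one>")
    case True
    then show ?thesis
      using g by (simp add: R_one)
  next
    case False
    then have "h \<noteq> \<one>"
      using g by auto
    with False show ?thesis
      using d g by (intro eq_matI)
        (auto simp: entry gram_mult_inverse y_eq d_def simp del: index_mult_mat(1))
  qed
  have orth: "real_orthogonal_mat d (R g)" if g: "g \<in> carrier G" for g
    using R_mult_inv[of g "inv g"] R_mult_inv[of "inv g" g] g
    by (simp add: real_orthogonal_mat_def flip: R_inv)
  have "\<exists>c. R g * R h = c \<cdot>\<^sub>m R (g \<otimes> h)" if gh: "g \<in> carrier G" "h \<in> carrier G" for g h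
  proof -
    consider "g = \<one>" | "h = \<one>" | "g \<otimes> h = \<one>" | "g \<noteq> \<one>" "h \<noteq> \<one>" "g \<otimes> h \<noteq> \<one>"
      by blast
    then show ?thesis
    proof cases
      case 1
      have "R g * R h = 1 \<cdot>\<^sub>m R (g \<otimes> h)"
        using gh by (simp add: 1 R_one R_smult left_mult_one_mat[of _ d d])
      then show ?thesis ..
    next
      case 2
      have "R g * R h = 1 \<cdot>\<^sub>m R (g \<otimes> h)"
        using gh by (simp add: 2 R_one R_smult right_mult_one_mat[of _ d d])
      then show ?thesis ..
    next
      case 3
      have "R g * R h = 1 \<cdot>\<^sub>m R (g \<otimes> h)"
        using gh by (simp add: 3 R_one R_smult R_mult_inv)
      then show ?thesis ..
    next
      case 4
      obtain c where c: "\<And>x z. x \<in> Y \<Longrightarrow> z \<in> Y \<Longrightarrow>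
          (\<Sum>w\<in>Y. gram g x w * gram h w z) = c * gram (g \<otimes> h) x z"
        using gram_mult[OF gh 4(3)] by blast
      \<comment> \<open>The product carries \<open>1 / d\<close> and the target
        \<open>1 / sqrt d\<close>, which leaves one root in the scalar.\<close>
      have "R g * R h = (c / sqrt (real d)) \<cdot>\<^sub>m R (g \<otimes> h)"
        using 4 by (intro eq_matI) (simp_all add: entry c R_def[of "g \<otimes> h"] del: index_mult_mat(1))
      then show ?thesis ..
    qed
  qed
  then obtain \<mu> where \<mu>: "\<And>g. g \<in> carrier G \<Longrightarrow> \<mu> g \<in> {1, -1}"
    and hom: "\<And>g h. g \<in> carrier G \<Longrightarrow> h \<in> carrier G \<Longrightarrow>
      (\<mu> g \<cdot>\<^sub>m R g) * (\<mu> h \<cdot>\<^sub>m R h) = \<mu> (g \<otimes> h) \<cdot>\<^sub>m R (g \<otimes> h)"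
    using projective_to_linear_representation[OF group_axioms assms d, of R] orth by blast
  have "real_representation G d (\<lambda>g. \<mu> g \<cdot>\<^sub>m R g) \<and> defines_MUBs G d (\<lambda>g. \<mu> g \<cdot>\<^sub>m R g)"
  proof (rule defines_MUBs_if_flat_representation[OF group_axioms d _ hom])
    fix g assume g: "g \<in> carrier G"
    have "(\<mu> g \<cdot>\<^sub>m A) * (\<mu> g \<cdot>\<^sub>m B) = A * B" if "A \<in> carrier_mat d d" "B \<in> carrier_mat d d" for A B
      using \<mu>[OF g] that
      by (auto simp: mult_smult_assoc_mat[of _ d d _ d] mult_smult_distrib[of _ d d _ d] smult_smult_mat)
    then show "real_orthogonal_mat d (\<mu> g \<cdot>\<^sub>m R g)"
      using orth[OF g] by (simp add: real_orthogonal_mat_def transpose_smult_mat)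
    fix i j assume "g \<noteq> \<one>" "i < d" "j < d"
    then show "((\<mu> g \<cdot>\<^sub>m R g) $$ (i, j))\<^sup>2 = 1 / real d"
      using \<mu>[OF g] gram_square[OF g, of "y i" "y j"]
      by (auto simp: R_def power2_eq_square)
  qed
  then show ?thesis
    unfolding d_def by blast
qed

end

section \<open>Quadratic refinements of alternating pairings\<close>

text \<open>
  Multiplicative form of the fact that an alternating bilinear form in characteristic 2 is the
  polar form of a quadratic form.
\<close>

lemma exists_quadratic_refinement:
  fixes W :: "'s :: ab_group_add set" and \<beta> :: "'s \<Rightarrow> 's \<Rightarrow> real"
  assumes finite: "finite W" and zero: "0 \<in> W"
    and add: "\<And>u v. u \<in> W \<Longrightarrow> v \<in> W \<Longrightarrow> u + v \<in> W"
    and double: "\<And>v :: 's. v + v = 0"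
    and square: "\<And>u v. u \<in> W \<Longrightarrow> v \<in> W \<Longrightarrow> \<beta> u v * \<beta> u v = 1"
    and left: "\<And>u v w. u \<in> W \<Longrightarrow> v \<in> W \<Longrightarrow> w \<in> W \<Longrightarrow> \<beta> (u + v) w = \<beta> u w * \<beta> v w"
    and right: "\<And>u v w. u \<in> W \<Longrightarrow> v \<in> W \<Longrightarrow> w \<in> W \<Longrightarrow> \<beta> u (v + w) = \<beta> u v * \<beta> u w"
    and alternating: "\<And>w. w \<in> W \<Longrightarrow> \<beta> w w = 1"
  shows "\<exists>\<chi> :: 's \<Rightarrow> real. (\<forall>w\<in>W. \<chi> w * \<chi> w = 1) \<and>
    (\<forall>u\<in>W. \<forall>w\<in>W. \<chi> (u + w) = \<chi> u * \<chi> w * \<beta> u w)"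
proof -
  \<comment> \<open>Polarize \<open>\<beta> (u + v) (u + v) = 1\<close>.\<close>
  have sym: "\<beta> u v = \<beta> v u" if "u \<in> W" "v \<in> W" for u v
  proof -
    have "\<beta> (u + v) (u + v) = (\<beta> u u * \<beta> u v) * (\<beta> v u * \<beta> v v)"
      by (simp only: left right add that ac_simps)
    then have "\<beta> u v * \<beta> v u = \<beta> u v * \<beta> u v"
      using that by (simp add: alternating add square)
    moreover have "\<beta> u v \<noteq> 0"
      using square[OF that] by auto
    ultimately show ?thesis
      by simp
  qed
  define refines where "refines U \<chi> \<longleftrightarrow> (\<forall>w\<in>U. \<chi> w * \<chi> w = 1) \<and>
    (\<forall>u\<in>U. \<forall>w\<in>U. \<chi> (u + w) = \<chi> u * \<chi> w * \<beta> u w)" for U and \<chi> :: "'s \<Rightarrow> real"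
  \<comment> \<open>A maximal subgroup carrying a refinement is shown to be all of
    \<open>W\<close>.\<close>
  define S where "S = {U. U \<subseteq> W \<and> 0 \<in> U \<and> (\<forall>u\<in>U. \<forall>v\<in>U. u + v \<in> U) \<and> (\<exists>\<chi>. refines U \<chi>)}"
  have "finite S"
    using finite by (intro finite_subset[of S "Pow W"]) (auto simp: S_def)
  moreover have "{0} \<in> S"
    using zero alternating[OF zero] by (auto simp: S_def refines_def intro!: exI[of _ "\<lambda>_. 1"])
  ultimately obtain U where U: "U \<in> S" and maximal: "\<And>U'. U' \<in> S \<Longrightarrow> U \<subseteq> U' \<Longrightarrow> U' = U"
    using finite_has_maximal[of S] by (metis empty_iff)
  then obtain \<chi> where \<chi>: "refines U \<chi>" and U_sub: "U \<subseteq> W" and U_zero: "0 \<in> U"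
    and U_add: "\<And>u v. u \<in> U \<Longrightarrow> v \<in> U \<Longrightarrow> u + v \<in> U"
    by (auto simp: S_def)
  have "U = W"
  proof (rule ccontr)
    assume "U \<noteq> W"
    then obtain t where t: "t \<in> W" "t \<notin> U"
      using U_sub by blast
    have cancel: "v + t + t = v" for v
      using double[of t] by (simp add: add.assoc)
    have disj: "v + t \<notin> U" if "v \<in> U" for v
    proof
      assume "v + t \<in> U"
      then have "v + (v + t) \<in> U"
        using that by (intro U_add[of v "v + t"])
      moreover have "v + (v + t) = t"
        using double[of v] by (simp flip: add.assoc)
      ultimately show False
        using t by simp
    qed
    define U' where "U' = U \<union> (\<lambda>v. v + t) ` U"
    \<comment> \<open>The extension is determined by choosing the value 1 at the new element
      \<open>t\<close>; then \<open>u + t\<close> must get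
      \<open>\<chi> u * \<beta> u t\<close>.\<close>
    define \<chi>' where "\<chi>' v = (if v \<in> U then \<chi> v else \<chi> (v + t) * \<beta> (v + t) t)" for v
    have W: "u \<in> W" if "u \<in> U" for u
      using U_sub that by blast
    have \<chi>'_U: "\<chi>' u = \<chi> u" and \<chi>'_t: "\<chi>' (u + t) = \<chi> u * \<beta> u t" if "u \<in> U" for u
      using that disj[OF that] by (simp_all add: \<chi>'_def cancel)
    have \<chi>_add: "\<chi> (u + v) = \<chi> u * \<chi> v * \<beta> u v" and \<chi>_square: "\<chi> u * \<chi> u = 1"
      if "u \<in> U" "v \<in> U" for u v
      using \<chi> that by (auto simp: refines_def)
    have shift: "u + (v + t) = (u + v) + t" "(u + t) + v = (u + v) + t" "(u + t) + (v + t) = u + v"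
      for u v
      using cancel[of "u + v"] by (simp_all add: ac_simps)
    have "refines U' \<chi>'"
      unfolding refines_def
    proof (intro conjI ballI)
      fix w assume "w \<in> U'"
      then consider "w \<in> U" | u where "u \<in> U" "w = u + t"
        by (auto simp: U'_def)
      then show "\<chi>' w * \<chi>' w = 1"
      proof cases
        case 1
        then show ?thesis
          by (simp add: \<chi>'_U \<chi>_square)
      next
        case 2
        have "\<chi>' w * \<chi>' w = (\<chi> u * \<chi> u) * (\<beta> u t * \<beta> u t)"
          using 2 by (simp add: \<chi>'_t)
        then show ?thesis
          using 2 t by (simp add: \<chi>_square square W)
      qed
    next
      fix p q assume "p \<in> U'" "q \<in> U'"
      then obtain u v where uv: "u \<in> U" "v \<in> U" and "p = u \<or> p = u + t" "q = v \<or> q = v + t"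
        by (auto simp: U'_def)
      then consider "p = u" "q = v" | "p = u" "q = v + t" | "p = u + t" "q = v" | "p = u + t" "q = v + t"
        by blast
      then show "\<chi>' (p + q) = \<chi>' p * \<chi>' q * \<beta> p q"
      proof cases
        case 1
        then show ?thesis
          using uv by (simp add: \<chi>'_U \<chi>_add U_add)
      next
        case 2
        then show ?thesis
          using uv t by (simp add: shift \<chi>'_U \<chi>'_t \<chi>_add U_add left right W)
      next
        case 3
        then show ?thesis
          using uv t by (simp add: shift \<chi>'_U \<chi>'_t \<chi>_add U_add left right W sym[of t])
      next
        case 4
        have "\<chi>' p * \<chi>' q * \<beta> p q = \<chi> u * \<chi> v * \<beta> u v * (\<beta> u t * \<beta> u t) * (\<beta> v t * \<beta> v t)"
          using 4 uv t by (simp add: \<chi>'_t left right W add alternating sym[of t])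
        also have "\<dots> = \<chi>' (u + v)"
          using uv t by (simp add: \<chi>'_U U_add \<chi>_add square W)
        also have "u + v = p + q"
          by (simp only: 4 shift(3))
        finally show ?thesis ..
      qed
    qed
    moreover have "\<forall>p\<in>U'. \<forall>q\<in>U'. p + q \<in> U'"
    proof (intro ballI)
      fix p q assume "p \<in> U'" "q \<in> U'"
      then obtain u v where uv: "u \<in> U" "v \<in> U" and "p = u \<or> p = u + t" "q = v \<or> q = v + t"
        by (auto simp: U'_def)
      then have "p + q = u + v \<or> p + q = (u + v) + t"
        using shift[of u v] by metis
      then show "p + q \<in> U'"
        using U_add[OF uv] by (auto simp: U'_def)
    qed
    moreover have "U' \<subseteq> W" "0 \<in> U'"
      using t by (auto simp: U'_def W add U_zero)
    ultimately have "U' \<in> S"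
      by (auto simp: S_def)
    then have "U' = U"
      by (rule maximal) (simp add: U'_def)
    then have "0 + t \<in> U"
      using U_zero by (auto simp: U'_def)
    then show False
      using t by simp
  qed
  with \<chi> show ?thesis
    unfolding refines_def by blast
qed

section \<open>The spin module in characteristic 2\<close>

declare add_bit_eq_xor [simp del] mult_bit_eq_and [simp del]
declare plus_fun_apply [simp del] zero_fun_apply [simp del]

lemmas spinor_eqs = fun_eq_iff plus_fun_apply zero_fun_apply

text \<open>Fock space over the field with two elements: each set of occupied modes has a
  coefficient.\<close>

type_synonym spinor = "nat set \<Rightarrow> bit"

lemma bit_double [simp]: "a + a = (0 :: bit)"
  by (cases a) simp_all

lemma spinor_double [simp]: "s + s = (0 :: spinor)"
  by (simp add: spinor_eqs)

lemma spinor_add_cancel [simp]: "s + (s + t) = (t :: spinor)"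
  by (simp flip: add.assoc)

definition flip :: "nat \<Rightarrow> nat set \<Rightarrow> nat set" where
  "flip i x = (if i \<in> x then x - {i} else insert i x)"

definition swap :: "nat \<Rightarrow> spinor \<Rightarrow> spinor" where
  "swap i s = (\<lambda>x. s (flip i x))"

text \<open>The annihilation operator (\<open>b = False\<close>) or the creation operator (\<open>b = True\<close>) of mode \<open>i\<close>.\<close>

definition ladder :: "bool \<Rightarrow> nat \<Rightarrow> spinor \<Rightarrow> spinor" where
  "ladder b i s = (\<lambda>x. if (i \<in> x) = b then s (flip i x) else 0)"

fun string :: "nat \<Rightarrow> spinor \<Rightarrow> spinor" where
  "string 0 s = 0"
| "string (Suc i) s = string i s + (swap i s + s)"

text \<open>
  Jordan-Wigner generators. No signs are needed in characteristic 2; the string consists of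
  operators \<open>swap j + 1\<close>, which have square zero and whose commutator with each ladder operator of
  mode \<open>j\<close> is 1.
\<close>

definition cliff :: "nat \<Rightarrow> spinor \<Rightarrow> spinor" where
  "cliff j s = string (j div 2) s + ladder (odd j) (j div 2) s"

section \<open>Relations between mode operators\<close>

lemma flip_flip [simp]: "flip i (flip i x) = x"
  by (auto simp: flip_def)

lemma flip_eq_iff: "flip i x = y \<longleftrightarrow> x = flip i y"
  by (metis flip_flip)

lemma flip_commute: "flip i (flip j x) = flip j (flip i x)"
  by (auto simp: flip_def)

lemma mem_flip [simp]: "j \<in> flip i x \<longleftrightarrow> (j \<in> x) \<noteq> (j = i)"
  by (auto simp: flip_def)

lemma swap_add: "swap i (s + t) = swap i s + swap i t"
  by (simp add: swap_def spinor_eqs)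

lemma ladder_add: "ladder b i (s + t) = ladder b i s + ladder b i t"
  by (simp add: ladder_def spinor_eqs)

lemma string_add: "string i (s + t) = string i s + string i t"
  by (induction i) (simp_all add: swap_add ac_simps)

lemma cliff_add: "cliff j (s + t) = cliff j s + cliff j t"
  by (simp add: cliff_def string_add ladder_add ac_simps)

lemma swap_zero [simp]: "swap i 0 = 0" and ladder_zero [simp]: "ladder b i 0 = 0"
  by (simp_all add: swap_def ladder_def spinor_eqs)

lemma string_zero [simp]: "string i 0 = 0"
  by (induction i) simp_all

lemma cliff_zero [simp]: "cliff j 0 = 0"
  by (simp add: cliff_def)

lemma swap_swap [simp]: "swap i (swap i s) = s"
  by (simp add: swap_def)

lemma swap_commute: "swap i (swap j s) = swap j (swap i s)"
  by (simp add: swap_def flip_commute)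

lemma swap_ladder_commute: "i \<noteq> j \<Longrightarrow> swap i (ladder b j s) = ladder b j (swap i s)"
  by (auto simp: swap_def ladder_def flip_commute spinor_eqs)

lemma swap_ladder: "swap i (ladder b i s) + ladder b i (swap i s) = s"
  by (auto simp: swap_def ladder_def spinor_eqs)

lemma ladder_commute: "i \<noteq> j \<Longrightarrow> ladder b i (ladder c j s) = ladder c j (ladder b i s)"
  by (auto simp: ladder_def flip_commute spinor_eqs)

lemma ladder_same [simp]: "ladder b i (ladder b i s) = 0"
  by (auto simp: ladder_def spinor_eqs)

lemma ladder_opposite: "b \<noteq> c \<Longrightarrow> ladder b i (ladder c i s) + ladder c i (ladder b i s) = s"
  by (auto simp: ladder_def spinor_eqs)

lemma ladder_sum: "ladder False i s + ladder True i s = swap i s"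
  by (auto simp: ladder_def swap_def spinor_eqs)

lemma swap_string_commute: "swap i (string j s) = string j (swap i s)"
  by (induction j) (simp_all add: swap_add swap_commute)

lemma string_commute: "string i (string j s) = string j (string i s)"
  by (induction i) (simp_all add: string_add swap_string_commute)

text \<open>The operators \<open>swap j + 1\<close> commute and have square zero; in the square of
  their sum the cross terms occur twice and cancel.\<close>

lemma string_same [simp]: "string i (string i s) = 0"
  by (induction i) (simp_all add: string_add swap_add swap_string_commute ac_simps)

lemma string_ladder_commute: "i \<le> j \<Longrightarrow> string i (ladder b j s) = ladder b j (string i s)"
  by (induction i) (simp_all add: ladder_add swap_ladder_commute)

text \<open>Only the summand of mode \<open>j\<close> in the string fails to commute with the ladder
  operator, and its commutator is the identity.\<close>

lemma string_ladder: "j < i \<Longrightarrow> string i (ladder b j s) + ladder b j (string i s) = s"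
proof (induction i)
  case (Suc i)
  show ?case
  proof (cases "j = i")
    case True
    then show ?thesis
      using swap_ladder[of i b s] by (simp add: ladder_add string_ladder_commute ac_simps)
  next
    case False
    then show ?thesis
      using Suc by (simp add: ladder_add swap_ladder_commute ac_simps)
  qed
qed simp

lemma cliff_square: "cliff j (cliff j s) = 0"
  by (simp add: cliff_def string_add ladder_add string_ladder_commute)

text \<open>Within one mode this is the relation between annihilation and creation. Otherwise the
  string of the higher generator contains the lower mode and contributes the identity by
  \<open>string_ladder\<close>; all other terms commute and cancel.\<close>

lemma cliff_anticommute_less:
  assumes "i < j"
  shows "cliff i (cliff j s) + cliff j (cliff i s) = s"
proof (cases "i div 2 = j div 2")
  case True
  then have "odd i \<noteq> odd j"
    using assms by presburger
  then show ?thesis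
    using True ladder_opposite[of "odd i" "odd j" "i div 2" s]
    by (simp add: cliff_def string_add ladder_add string_ladder_commute ac_simps)
next
  case False
  then have less: "i div 2 < j div 2"
    using assms by (simp add: div_le_mono le_neq_implies_less)
  then show ?thesis
    using string_ladder[OF less, of "odd i" s]
    by (simp add: cliff_def string_add ladder_add string_ladder_commute ac_simps
        ladder_commute[of "j div 2" "i div 2"] string_commute[of "j div 2" "i div 2"])
qed

lemma spinor_move: "s + t = u \<Longrightarrow> s = t + (u :: spinor)"
  by (metis add.commute spinor_add_cancel)

lemma cliff_anticommute: "i \<noteq> j \<Longrightarrow> cliff i (cliff j s) + cliff j (cliff i s) = s"
  using cliff_anticommute_less[of i j s] cliff_anticommute_less[of j i s]
  by (cases "i < j") (simp_all add: ac_simps)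

section \<open>Sums, counting and signs over the field with two elements\<close>

text \<open>The orbits are pairs on which \<open>f\<close> is constant, and each pair cancels in
  characteristic 2.\<close>

lemma sum_bit_involution:
  fixes f :: "'a \<Rightarrow> bit"
  assumes "finite A" "\<And>x. x \<in> A \<Longrightarrow> \<iota> x \<in> A" "\<And>x. x \<in> A \<Longrightarrow> \<iota> (\<iota> x) = x"
    "\<And>x. x \<in> A \<Longrightarrow> \<iota> x \<noteq> x" "\<And>x. x \<in> A \<Longrightarrow> f (\<iota> x) = f x"
  shows "sum f A = 0"
  using assms
proof (induction A rule: finite_psubset_induct)
  case (psubset A)
  show ?case
  proof (cases "A = {}")
    case False
    then obtain x where x: "x \<in> A"
      by blast
    let ?B = "A - {x, \<iota> x}"
    have "sum f ?B = 0"
    proof (rule psubset.IH)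
      fix y assume y: "y \<in> ?B"
      then have "\<iota> y \<noteq> x" "\<iota> y \<noteq> \<iota> x"
        using psubset.prems(2) x by (metis Diff_iff insert_iff)+
      then show "\<iota> y \<in> ?B"
        using psubset.prems(1) y by blast
    qed (use x psubset.prems in auto)
    moreover have "sum f A = sum f ?B + sum f {x, \<iota> x}"
      using psubset.hyps x psubset.prems(1) by (intro sum.subset_diff) auto
    moreover have "x \<notin> {\<iota> x}"
      using psubset.prems(3)[OF x] by (metis singletonD)
    then have "sum f {x, \<iota> x} = 0"
      using psubset.prems(4)[OF x] by simp
    ultimately show ?thesis
      by simp
  qed simp
qed

lemma card_supported_functions:
  assumes "finite I"
  shows "card {s :: 'a \<Rightarrow> bit. \<forall>x. x \<notin> I \<longrightarrow> s x = 0} = 2 ^ card I"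
proof -
  have "bij_betw (\<lambda>s :: 'a \<Rightarrow> bit. {x. s x = 1}) {s. \<forall>x. x \<notin> I \<longrightarrow> s x = 0} (Pow I)"
  proof (rule bij_betw_byWitness[where f' = "\<lambda>F x. of_bool (x \<in> F)"])
    show "\<forall>s\<in>{s :: 'a \<Rightarrow> bit. \<forall>x. x \<notin> I \<longrightarrow> s x = 0}. (\<lambda>x. of_bool (x \<in> {x. s x = 1})) = s"
    proof (intro ballI ext)
      fix s :: "'a \<Rightarrow> bit" and x
      show "of_bool (x \<in> {x. s x = 1}) = s x"
        by (cases "s x") simp_all
    qed
    show "(\<lambda>s :: 'a \<Rightarrow> bit. {x. s x = 1}) ` {s. \<forall>x. x \<notin> I \<longrightarrow> s x = 0} \<subseteq> Pow I"
      by fastforce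
  qed auto
  then show ?thesis
    using assms by (simp add: bij_betw_same_card card_Pow)
qed

definition bit_sign :: "bit \<Rightarrow> real" where
  "bit_sign b = (if b = 0 then 1 else -1)"

lemma bit_sign_add: "bit_sign (a + b) = bit_sign a * bit_sign b"
  by (cases a; cases b) (simp_all add: bit_sign_def)

lemma bit_sign_square: "bit_sign a * bit_sign a = 1"
  by (simp add: bit_sign_def)

lemma bit_sign_zero [simp]: "bit_sign 0 = 1"
  by (simp add: bit_sign_def)

section \<open>The spin module and its quadratic form\<close>

locale spin_module =
  fixes k :: nat
  assumes k_ge_3: "3 \<le> k"
begin

definition V :: "spinor set" where
  "V = {s. \<forall>x. \<not> x \<subseteq> {..<k} \<longrightarrow> s x = 0}"

text \<open>Leaving out the sets with mode 0 keeps one set from each complementary pair, so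
  \<open>form s s\<close> is a quadratic form whose polar form is the full sum in
  \<open>form_polar\<close>.\<close>

definition form :: "spinor \<Rightarrow> spinor \<Rightarrow> bit" where
  "form s t = (\<Sum>x\<in>Pow {1..<k}. s x * t ({..<k} - x))"

text \<open>
  The lifts preserve the quadratic form \<open>form s s\<close>, but in general not \<open>form\<close> itself.
\<close>

definition implements :: "(nat \<Rightarrow> nat) \<Rightarrow> (spinor \<Rightarrow> spinor) \<Rightarrow> bool" where
  "implements \<pi> T \<longleftrightarrow> (\<forall>s\<in>V. T s \<in> V) \<and> (\<forall>s\<in>V. \<forall>t\<in>V. T (s + t) = T s + T t) \<and> inj_on T V \<and>
    (\<forall>s\<in>V. form (T s) (T s) = form s s) \<and> (\<forall>s\<in>V. \<forall>j\<le>2 * k. T (cliff j s) = cliff (\<pi> j) (T s))"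

lemma zero_V [simp]: "0 \<in> V" and add_V: "s \<in> V \<Longrightarrow> t \<in> V \<Longrightarrow> s + t \<in> V"
  by (simp_all add: V_def spinor_eqs)

lemma V_iff: "s \<in> V \<longleftrightarrow> (\<forall>x. \<not> x \<subseteq> {..<k} \<longrightarrow> s x = 0)"
  by (simp add: V_def)

lemma flip_subset_iff: "i < k \<Longrightarrow> flip i x \<subseteq> {..<k} \<longleftrightarrow> x \<subseteq> {..<k}"
  by (auto simp: flip_def)

lemma swap_V: "i < k \<Longrightarrow> s \<in> V \<Longrightarrow> swap i s \<in> V"
  by (simp add: V_iff swap_def flip_subset_iff)

lemma string_V: "i \<le> k \<Longrightarrow> s \<in> V \<Longrightarrow> string i s \<in> V"
  by (induction i) (simp_all add: add_V swap_V)

lemma ladder_V: "i < k \<Longrightarrow> s \<in> V \<Longrightarrow> ladder b i s \<in> V"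
  by (simp add: V_iff ladder_def flip_subset_iff)

text \<open>This accommodates an odd number of generators on \<open>k\<close> modes: generator
  \<open>2 * k\<close> would need mode \<open>k\<close>, and on \<open>V\<close> only its string
  remains.\<close>

lemma ladder_outside: "s \<in> V \<Longrightarrow> ladder False k s = 0"
  by (auto simp: V_iff ladder_def spinor_eqs flip_def)

lemma cliff_V:
  assumes "j \<le> 2 * k" "s \<in> V"
  shows "cliff j s \<in> V"
proof (cases "j = 2 * k")
  case True
  then show ?thesis
    using assms by (simp add: cliff_def ladder_outside string_V)
next
  case False
  then have "j div 2 < k"
    using assms by auto
  then show ?thesis
    using assms by (simp add: cliff_def add_V string_V ladder_V)
qed

lemma form_add_left: "form (s + t) u = form s u + form t u"
  and form_add_right: "form u (s + t) = form u s + form u t"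
  by (simp_all add: form_def plus_fun_apply sum.distrib ring_distribs)

lemma form_polar: "form s t + form t s = (\<Sum>x\<in>Pow {..<k}. s x * t ({..<k} - x))"
proof -
  let ?K = "{..<k}" and ?A = "Pow {1..<k}"
  have "(\<Sum>x\<in>Pow ?K. s x * t (?K - x)) =
    (\<Sum>x\<in>?A. s x * t (?K - x)) + (\<Sum>x\<in>Pow ?K - ?A. s x * t (?K - x))"
    by (subst add.commute, rule sum.subset_diff) auto
  also have "(\<Sum>x\<in>Pow ?K - ?A. s x * t (?K - x)) = (\<Sum>x\<in>?A. t x * s (?K - x))"
  proof (rule sum.reindex_bij_witness[of _ "\<lambda>x. ?K - x" "\<lambda>x. ?K - x"])
    fix x assume x: "x \<in> Pow ?K - ?A"
    then show "?K - (?K - x) = x"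
      by auto
    show "?K - x \<in> ?A"
      using x by (auto simp: Suc_le_eq intro: gr0I)
    show "t (?K - x) * s (?K - (?K - x)) = s x * t (?K - x)"
      using \<open>?K - (?K - x) = x\<close> by (simp add: mult.commute)
  next
    fix x assume x: "x \<in> ?A"
    then show "?K - (?K - x) = x"
      by auto
    have "0 \<in> ?K - x"
      using x k_ge_3 by auto
    moreover have "0 \<notin> {1..<k}"
      by simp
    ultimately show "?K - x \<in> Pow ?K - ?A"
      by blast
  qed
  finally show ?thesis
    by (simp add: form_def)
qed

lemma form_add_self: "form (s + t) (s + t) = form s s + form t t + (form s t + form t s)"
  by (simp add: form_add_left form_add_right ac_simps)

text \<open>Flipping a mode commutes with complementation. For \<open>i \<noteq> 0\<close> it
  permutes the summation range; for \<open>i = 0\<close> it leaves the range, and passing to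
  complements leads back.\<close>

lemma form_swap:
  assumes i: "i < k"
  shows "form (swap i s) (swap i s) = form s s"
proof -
  let ?K = "{..<k}" and ?A = "Pow {1..<k}"
  define f where "f x = s x * s (?K - x)" for x
  have "form (swap i s) (swap i s) = (\<Sum>x\<in>?A. f (flip i x))"
    unfolding form_def
  proof (rule sum.cong)
    fix x assume "x \<in> ?A"
    then have "flip i (?K - x) = ?K - flip i x"
      using i by (auto simp: flip_def)
    then show "swap i s x * swap i s (?K - x) = f (flip i x)"
      by (simp add: swap_def f_def)
  qed simp
  also have "\<dots> = (\<Sum>x\<in>?A. f x)"
  proof (cases "i = 0")
    case True
    show ?thesis
    proof (rule sum.reindex_bij_witness[of _ "\<lambda>x. {1..<k} - x" "\<lambda>x. {1..<k} - x"])
      fix x assume x: "x \<in> ?A"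
      have *: "flip 0 x = ?K - ({1..<k} - x)" "?K - (?K - ({1..<k} - x)) = {1..<k} - x"
        using x k_ge_3 by (auto simp: flip_def)
      show "f ({1..<k} - x) = f (flip i x)"
        unfolding True f_def * by (simp add: mult.commute)
    qed auto
  next
    case False
    then show ?thesis
      using i by (intro sum.reindex_bij_witness[of _ "flip i" "flip i"])
        (auto simp: flip_def split: if_splits)
  qed
  finally show ?thesis
    by (simp add: f_def form_def)
qed

lemma form_ladder_self:
  assumes "i < k"
  shows "form (ladder False i s) (ladder False i s) = 0"
  unfolding form_def
proof (intro sum.neutral ballI)
  fix x
  show "ladder False i s x * ladder False i s ({..<k} - x) = 0"
    using assms by (cases "i \<in> x") (simp_all add: ladder_def)
qed

text \<open>The surviving terms cancel in pairs under complementing all modes but \<open>i\<close>,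
  which has no fixed point because a second mode exists.\<close>

lemma polar_ladder:
  assumes i: "i < k"
  shows "form s (ladder False i s) + form (ladder False i s) s = 0"
proof -
  let ?K = "{..<k}" and ?\<iota> = "\<lambda>x. insert i ({..<k} - x)"
  have "(\<Sum>x\<in>Pow ?K. s x * ladder False i s (?K - x)) = (\<Sum>x\<in>{x\<in>Pow ?K. i \<in> x}. s x * s (?\<iota> x))"
    by (rule sum.mono_neutral_cong_right) (use i in \<open>auto simp: ladder_def flip_def\<close>)
  also have "\<dots> = 0"
  proof (rule sum_bit_involution[of _ ?\<iota>])
    fix x assume "x \<in> {x\<in>Pow ?K. i \<in> x}"
    then show *: "?\<iota> (?\<iota> x) = x"
      by auto
    show "s (?\<iota> x) * s (?\<iota> (?\<iota> x)) = s x * s (?\<iota> x)"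
      unfolding * by (rule mult.commute)
    define j where "j = (if i = 0 then 1 else 0 :: nat)"
    have "j \<in> ?K" "j \<noteq> i"
      using k_ge_3 by (auto simp: j_def)
    then show "?\<iota> x \<noteq> x"
      by blast
  qed (use i in auto)
  finally show ?thesis
    by (simp add: form_polar)
qed

text \<open>The pairing complements all modes except \<open>i\<close> and \<open>j\<close>. A third
  mode rules out fixed points; this is where three modes are used.\<close>

lemma polar_ladder_ladder:
  assumes ij: "i < k" "j < k" "i \<noteq> j"
  shows "form (ladder False i s) (ladder False j s) + form (ladder False j s) (ladder False i s) = 0"
proof -
  let ?K = "{..<k}" and ?\<iota> = "\<lambda>x. insert j ({..<k} - x - {i})"
  let ?f = "\<lambda>x. s (insert i x) * s (insert j (?K - x))"
  have "(\<Sum>x\<in>Pow ?K. ladder False i s x * ladder False j s (?K - x)) =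
    (\<Sum>x\<in>{x\<in>Pow ?K. i \<notin> x \<and> j \<in> x}. ?f x)"
  proof (rule sum.mono_neutral_cong_right)
    show "\<forall>x\<in>Pow ?K - {x\<in>Pow ?K. i \<notin> x \<and> j \<in> x}. ladder False i s x * ladder False j s (?K - x) = 0"
    proof
      fix x assume "x \<in> Pow ?K - {x\<in>Pow ?K. i \<notin> x \<and> j \<in> x}"
      then have "i \<in> x \<or> j \<in> ?K - x"
        using ij by blast
      then show "ladder False i s x * ladder False j s (?K - x) = 0"
        by (elim disjE) (simp_all add: ladder_def)
    qed
  qed (auto simp: ladder_def flip_def)
  also have "\<dots> = 0"
  proof (rule sum_bit_involution[of _ ?\<iota>])
    fix x assume x: "x \<in> {x\<in>Pow ?K. i \<notin> x \<and> j \<in> x}"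
    then show "?\<iota> (?\<iota> x) = x"
      by auto
    have "insert i (?\<iota> x) = insert j (?K - x)" "insert j (?K - ?\<iota> x) = insert i x"
      using x ij by auto
    then show "?f (?\<iota> x) = ?f x"
      by (simp add: mult.commute)
    obtain l where "l \<in> ?K" "l \<noteq> i" "l \<noteq> j"
    proof -
      have "\<not> ?K \<subseteq> {i, j}"
        using card_mono[of "{i, j}" ?K] k_ge_3 ij(3) by auto
      then show thesis
        using that by blast
    qed
    then show "?\<iota> x \<noteq> x"
      by blast
  qed (use ij in auto)
  finally show ?thesis
    by (simp add: form_polar)
qed

section \<open>Lifting permutations of the generators\<close>

lemma cliff_even_odd: "cliff (2 * i) s + cliff (Suc (2 * i)) s = swap i s"
  by (simp add: cliff_def ac_simps flip: ladder_sum[of i])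

lemma cliff_odd_even:
  "cliff (Suc (2 * i)) s + cliff (Suc (Suc (2 * i))) s = s + ladder False i s + ladder False (Suc i) s"
  by (simp add: cliff_def ac_simps flip: ladder_sum[of i])

text \<open>In characteristic 2 the sum of two generators acts as the reflection exchanging them:
  its square is the anticommutator 1, and past any third generator the two unit terms cancel.
  Adjacent generators are chosen because their strings telescope, which makes the quadratic form
  accessible.\<close>

lemma implements_adjacent:
  assumes j: "j < 2 * k"
  shows "implements (Transposition.transpose j (Suc j)) (\<lambda>s. cliff j s + cliff (Suc j) s)"
proof -
  define T where "T s = cliff j s + cliff (Suc j) s" for s
  have add: "T (s + t) = T s + T t" for s t
    by (simp add: T_def cliff_add ac_simps)
  have anti: "cliff j (cliff (Suc j) s) = cliff (Suc j) (cliff j s) + s" for s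
    by (rule spinor_move[OF cliff_anticommute]) simp
  have involution: "T (T s) = s" for s
    by (simp add: T_def cliff_add cliff_square anti ac_simps)
  have "form (T s) (T s) = form s s" if s: "s \<in> V" for s
  proof (cases "even j")
    case True
    then obtain i where i: "j = 2 * i"
      by blast
    then show ?thesis
      using j by (simp add: T_def cliff_even_odd form_swap)
  next
    case False
    then obtain i where i: "j = Suc (2 * i)"
      by (metis oddE Suc_eq_plus1)
    then have ik: "i < k"
      using j by simp
    have 1: "form (s + ladder False i s) (s + ladder False i s) = form s s"
      by (simp add: form_add_self[of s] form_ladder_self[OF ik] polar_ladder[OF ik])
    \<comment> \<open>When the upper generator is the last one, its annihilation term vanishes on
      \<open>V\<close>.\<close>
    show ?thesis
    proof (cases "Suc i = k")
      case True
      then show ?thesis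
        using s 1 by (simp add: T_def i cliff_odd_even ladder_outside)
    next
      case False
      then have ik': "Suc i < k"
        using ik by simp
      show ?thesis
      proof -
        let ?A = "s + ladder False i s" and ?C = "ladder False (Suc i) s"
        have "form ?A ?C + form ?C ?A = (form s ?C + form ?C s) +
          (form (ladder False i s) ?C + form ?C (ladder False i s))"
          by (simp add: form_add_left form_add_right ac_simps)
        then have "form ?A ?C + form ?C ?A = 0"
          by (simp add: polar_ladder[OF ik'] polar_ladder_ladder[OF ik ik'])
        then show ?thesis
          by (simp add: T_def i cliff_odd_even form_add_self[of ?A] 1 form_ladder_self[OF ik'])
      qed
    qed
  qed
  moreover have "T (cliff l s) = cliff (Transposition.transpose j (Suc j) l) (T s)" for l s
  proof -
    consider "l = j" | "l = Suc j" | "l \<noteq> j" "l \<noteq> Suc j"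
      by blast
    then show ?thesis
    proof cases
      case 3
      have "cliff j (cliff l s) = cliff l (cliff j s) + s"
        "cliff (Suc j) (cliff l s) = cliff l (cliff (Suc j) s) + s"
        using 3 by (auto intro!: spinor_move cliff_anticommute)
      then show ?thesis
        using 3 by (simp add: T_def transpose_def cliff_add ac_simps)
    qed (simp_all add: T_def cliff_add cliff_square)
  qed
  moreover have "T s \<in> V" if "s \<in> V" for s
    using that j by (simp add: T_def add_V cliff_V)
  moreover have "inj_on T V"
    by (rule inj_on_inverseI[of _ T]) (rule involution)
  ultimately have "implements (Transposition.transpose j (Suc j)) T"
    by (simp add: implements_def add)
  then show ?thesis
    by (simp add: T_def[abs_def])
qed

lemma implements_comp:
  assumes "implements \<pi> T" "implements \<rho> S" "\<And>j. j \<le> 2 * k \<Longrightarrow> \<rho> j \<le> 2 * k"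
  shows "implements (\<pi> \<circ> \<rho>) (T \<circ> S)"
proof -
  have "inj_on (T \<circ> S) V"
    using assms by (intro comp_inj_on) (auto simp: implements_def intro: inj_on_subset[of T V])
  then show ?thesis
    using assms by (simp add: implements_def)
qed

lemma implements_id: "implements id id"
  by (simp add: implements_def)

text \<open>Conjugation by adjacent transpositions moves the upper index up one step at a
  time.\<close>

lemma implements_transposition:
  assumes "a < b" "b \<le> 2 * k"
  shows "\<exists>T. implements (Transposition.transpose a b) T"
  using assms
proof (induction b)
  case (Suc b)
  let ?t = "Transposition.transpose b (Suc b)"
  obtain S where S: "implements ?t S"
    using implements_adjacent[of b] Suc.prems by auto
  show ?case
  proof (cases "a = b")
    case False
    then obtain T where T: "implements (Transposition.transpose a b) T"
      using Suc by auto
    have "implements (?t \<circ> (Transposition.transpose a b \<circ> ?t)) (S \<circ> (T \<circ> S))"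
      using Suc.prems by (intro implements_comp S T) (auto simp: transpose_def)
    moreover have "?t \<circ> (Transposition.transpose a b \<circ> ?t) = Transposition.transpose a (Suc b)"
      using False Suc.prems by (auto simp: transpose_def spinor_eqs)
    ultimately show ?thesis
      by auto
  qed (use S in auto)
qed simp

lemma implements_permutation:
  assumes "\<pi> permutes {..2 * k}"
  shows "\<exists>T. implements \<pi> T"
  using assms finite_atMost
proof (induction \<pi> rule: permutes_induct)
  case id
  then show ?case
    using implements_id by blast
next
  case (swap a b p)
  then obtain T S where "implements p T" "implements (Transposition.transpose a b) S"
    using implements_transposition[of a b] implements_transposition[of b a]
    by (metis atMost_iff linorder_neqE_nat transpose_commute)
  then have "implements (Transposition.transpose a b \<circ> p) (S \<circ> T)"
    using swap.hyps permutes_in_image[OF \<open>p permutes {..2 * k}\<close>] by (intro implements_comp) auto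
  then show ?case
    by blast
qed

definition basis_spinor :: "nat set \<Rightarrow> spinor" where
  "basis_spinor x = (\<lambda>y. of_bool (y = x))"

text \<open>
  Schur's lemma: an operator commuting with the Clifford generators fixes the vacuum
  \<open>basis_spinor {}\<close>, the only nonzero spinor annihilated by all modes, and therefore every
  basis spinor, since these arise from the vacuum by mode swaps.
\<close>

lemma implements_id_unique:
  assumes T: "implements id T" and s: "s \<in> V"
  shows "T s = s"
proof -
  have T_V: "T s \<in> V" and T_cliff: "j \<le> 2 * k \<Longrightarrow> T (cliff j s) = cliff j (T s)"
    if "s \<in> V" for s j
    using T that by (auto simp: implements_def)
  have T_add: "T (s + t) = T s + T t" if "s \<in> V" "t \<in> V" for s t
    using T that by (auto simp: implements_def)
  have inj: "inj_on T V"
    using T by (simp add: implements_def)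
  have T_zero: "T 0 = 0"
    using T_add[of 0 0] by simp
  \<comment> \<open>Swaps are sums of two generators, so they commute with \<open>T\<close>; hence
    so do strings, and then annihilation operators.\<close>
  have T_swap: "T (swap i s) = swap i (T s)" if "i < k" "s \<in> V" for i s
    using that by (simp flip: cliff_even_odd add: T_add T_cliff cliff_V)
  have T_string: "T (string i s) = string i (T s)" if "i \<le> k" "s \<in> V" for i s
    using that by (induction i) (simp_all add: T_zero T_add T_swap string_V swap_V add_V)
  have ladder_eq: "ladder False i s = cliff (2 * i) s + string i s" for i s
    by (simp add: cliff_def ac_simps)
  have T_ladder: "T (ladder False i s) = ladder False i (T s)" if "i < k" "s \<in> V" for i s
    using that by (simp add: ladder_eq T_add T_cliff T_string cliff_V string_V)
  have basis_V: "basis_spinor x \<in> V" if "x \<subseteq> {..<k}" for x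
    using that by (auto simp: V_iff basis_spinor_def)
  have vacuum: "T (basis_spinor {}) = basis_spinor {}"
  proof -
    define v where "v = T (basis_spinor {})"
    have v_V: "v \<in> V"
      using T_V[OF basis_V[of "{}"]] by (simp add: v_def)
    have "ladder False i (basis_spinor {}) = 0" for i
      by (auto simp: ladder_def basis_spinor_def flip_def spinor_eqs)
    then have annihilated: "ladder False i v = 0" if "i < k" for i
      using T_ladder[OF that basis_V[of "{}"]] by (simp add: v_def T_zero)
    \<comment> \<open>Annihilating an occupied mode \<open>i\<close> of \<open>x\<close> shows the
      coefficient \<open>v x\<close> at \<open>x - {i}\<close>.\<close>
    have v_zero: "v x = 0" if nonempty: "x \<noteq> {}" for x
    proof (cases "x \<subseteq> {..<k}")
      case True
      obtain i where "i \<in> x"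
        using nonempty by blast
      with True have i: "i \<in> x" "i < k"
        by auto
      have "ladder False i v (x - {i}) = 0"
        by (simp add: annihilated i zero_fun_apply)
      then show ?thesis
        using i by (simp add: ladder_def flip_def insert_absorb)
    qed (use v_V in \<open>simp add: V_iff\<close>)
    have "basis_spinor {} \<noteq> 0"
      by (auto simp: basis_spinor_def spinor_eqs)
    then have "v \<noteq> 0"
      using inj_onD[OF inj, of "basis_spinor {}" 0] basis_V[of "{}"] by (auto simp: v_def T_zero)
    then have "v {} \<noteq> 0"
      using v_zero unfolding spinor_eqs by metis
    \<comment> \<open>The remaining coefficient is nonzero, hence 1: there is no other
      scalar.\<close>
    have "v = basis_spinor {}"
    proof (intro ext)
      fix x
      show "v x = basis_spinor {} x"
        using v_zero[of x] \<open>v {} \<noteq> 0\<close> by (cases "x = {}") (simp_all add: basis_spinor_def)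
    qed
    then show ?thesis
      by (simp add: v_def)
  qed
  have T_basis: "T (basis_spinor x) = basis_spinor x" if "x \<subseteq> {..<k}" for x
    using finite_subset[OF that finite_lessThan] that
  proof (induction x rule: finite_induct)
    case (insert i x)
    have "basis_spinor (insert i x) = swap i (basis_spinor x)"
      using insert.hyps by (simp add: basis_spinor_def swap_def flip_eq_iff) (simp add: flip_def)
    then show ?case
      using insert by (simp add: T_swap basis_V)
  qed (rule vacuum)
  have T_indicator: "T (\<lambda>x. of_bool (x \<in> F)) = (\<lambda>x. of_bool (x \<in> F))" if "F \<subseteq> Pow {..<k}" for F
  proof -
    have "finite F"
      using that finite_subset by blast
    then show ?thesis
      using that
    proof (induction F rule: finite_induct)
      case empty
      then show ?case
        using T_zero by (simp add: zero_fun_def)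
    next
      case (insert y F)
      have "(\<lambda>x. of_bool (x \<in> insert y F)) = basis_spinor y + (\<lambda>x. of_bool (x \<in> F))"
        using insert.hyps by (auto simp: basis_spinor_def spinor_eqs)
      moreover have "(\<lambda>x. of_bool (x \<in> F)) \<in> V"
        using insert.prems by (auto simp: V_iff)
      ultimately show ?case
        using insert by (simp add: T_add T_basis basis_V)
    qed
  qed
  have "s = (\<lambda>x. of_bool (x \<in> {x. s x \<noteq> 0}))"
    by (auto simp: spinor_eqs)
  moreover have "{x. s x \<noteq> 0} \<subseteq> Pow {..<k}"
    using s by (auto simp only: V_def)
  ultimately show ?thesis
    using T_indicator by metis
qed

text \<open>Composing both lifts with a lift of the inverse permutation reduces this to the identity
  permutation, since that lift is injective on \<open>V\<close>.\<close>

lemma implements_unique: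
  assumes T: "implements \<pi> T" and S: "implements \<pi> S" and \<pi>: "\<pi> permutes {..2 * k}" and s: "s \<in> V"
  shows "T s = S s"
proof -
  obtain U where U: "implements (inv_into UNIV \<pi>) U"
    using implements_permutation[OF permutes_inv[OF \<pi>]] by blast
  have "\<pi> j \<le> 2 * k" if "j \<le> 2 * k" for j
    using permutes_in_image[OF \<pi>] that by simp
  then have "implements (inv_into UNIV \<pi> \<circ> \<pi>) (U \<circ> T)" "implements (inv_into UNIV \<pi> \<circ> \<pi>) (U \<circ> S)"
    using T S U by (auto intro: implements_comp)
  then have "U (T s) = U (S s)"
    using implements_id_unique[of "U \<circ> T"] implements_id_unique[of "U \<circ> S"] s permutes_inv_o(2)[OF \<pi>]
    by simp
  then show ?thesis
    using U T S s by (auto simp: implements_def dest: inj_onD)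
qed

section \<open>The totally singular subspace\<close>

definition W :: "spinor set" where
  "W = {s. \<forall>x. x \<notin> Pow {1..<k} \<longrightarrow> s x = 0}"

definition Y :: "spinor set" where
  "Y = {s \<in> V. \<forall>x. 0 \<notin> x \<longrightarrow> s x = 0}"

lemma card_W: "card W = 2 ^ 2 ^ (k - 1)"
  unfolding W_def by (subst card_supported_functions) (simp_all add: card_Pow)

lemma V_eq: "V = {s. \<forall>x. x \<notin> Pow {..<k} \<longrightarrow> s x = 0}"
  by (simp add: V_def)

lemma card_V: "card V = card W * card W"
proof -
  have "card V = 2 ^ 2 ^ k"
    unfolding V_eq by (subst card_supported_functions) (simp_all add: card_Pow)
  also have "(2 :: nat) ^ k = 2 ^ (k - 1) + 2 ^ (k - 1)"
    using k_ge_3 by (cases k) simp_all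
  finally show ?thesis
    by (simp add: card_W power_add)
qed

lemma finite_V: "finite V"
  by (rule card_ge_0_finite) (simp add: card_V card_W)

lemma W_sub: "W \<subseteq> V"
  by (fastforce simp: W_def V_def)

lemma W_add: "s \<in> W \<Longrightarrow> t \<in> W \<Longrightarrow> s + t \<in> W"
  by (simp add: W_def plus_fun_apply)

lemma W_iff_zero: "s \<in> W \<longleftrightarrow> s \<in> V \<and> (\<forall>x. 0 \<in> x \<longrightarrow> s x = 0)"
proof -
  have "x \<in> Pow {1..<k} \<longleftrightarrow> x \<subseteq> {..<k} \<and> 0 \<notin> x" for x
    by (auto simp: Suc_le_eq intro: gr0I)
  then show ?thesis
    by (auto simp: W_def V_def)
qed

text \<open>Generator 0 has an empty string and is the annihilation operator of mode 0. Describing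
  \<open>W\<close> as its kernel shows how permutations of generators move \<open>W\<close>.\<close>

lemma W_iff: "s \<in> W \<longleftrightarrow> s \<in> V \<and> cliff 0 s = 0"
proof -
  have "(\<forall>x. 0 \<in> x \<longrightarrow> s x = 0) \<longleftrightarrow> ladder False 0 s = 0"
    unfolding ladder_def spinor_eqs flip_def
    by (auto split: if_splits) (metis insert_absorb mk_disjoint_insert)
  then show ?thesis
    by (simp add: W_iff_zero cliff_def)
qed

lemma form_W: "s \<in> W \<Longrightarrow> form s s = 0"
  unfolding form_def
proof (intro sum.neutral ballI)
  fix x assume s: "s \<in> W" and x: "x \<in> Pow {1..<k}"
  have "0 \<in> {..<k} - x"
    using x k_ge_3 by auto
  then show "s x * s ({..<k} - x) = 0"
    using s by (simp add: W_iff_zero)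
qed

lemma W_transversal:
  assumes v: "v \<in> V"
  shows "\<exists>!y. y \<in> Y \<and> v + y \<in> W"
proof (rule ex1I)
  let ?y = "\<lambda>x. if 0 \<in> x then v x else 0"
  show "?y \<in> Y \<and> v + ?y \<in> W"
    using v by (auto simp: Y_def W_iff_zero V_iff plus_fun_apply)
  fix y assume y: "y \<in> Y \<and> v + y \<in> W"
  show "y = ?y"
  proof
    fix x
    show "y x = ?y x"
    proof (cases "0 \<in> x")
      case True
      then have "v x + y x = 0"
        using y by (simp add: W_iff_zero plus_fun_apply)
      then show ?thesis
        using True by (cases "v x"; cases "y x") simp_all
    qed (use y in \<open>simp add: Y_def\<close>)
  qed
qed

lemma W_maximal:
  assumes s: "s \<in> V" and orth: "\<And>w. w \<in> W \<Longrightarrow> form w s + form s w = 0"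
  shows "s \<in> W"
  unfolding W_iff_zero
proof (intro conjI allI impI s)
  fix x :: "nat set" assume x: "0 \<in> x"
  show "s x = 0"
  proof (cases "x \<subseteq> {..<k}")
    case True
    \<comment> \<open>Pairing with the basis spinor of the complement extracts the coefficient at
      \<open>x\<close>.\<close>
    let ?w = "basis_spinor ({..<k} - x)"
    have "?w \<in> W"
      using x by (auto simp: W_iff_zero V_iff basis_spinor_def)
    then have "0 = (\<Sum>y\<in>Pow {..<k}. ?w y * s ({..<k} - y))"
      using orth by (simp flip: form_polar)
    also have "\<dots> = (\<Sum>y\<in>{{..<k} - x}. ?w y * s ({..<k} - y))"
      by (rule sum.mono_neutral_right) (auto simp: basis_spinor_def)
    also have "\<dots> = s ({..<k} - ({..<k} - x))"
      by (simp add: basis_spinor_def)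
    also have "{..<k} - ({..<k} - x) = x"
      using True by blast
    finally show ?thesis
      by simp
  qed (use s in \<open>simp add: V_iff\<close>)
qed

section \<open>The action of the group on the spin module\<close>

theorem flat_representation:
  fixes G :: "('g, 'm) monoid_scheme" (structure)
  assumes "group G" "finite (carrier G)" and order: "Coset.order G = 2 * k + 1"
  shows "\<exists>R. real_representation G (2 ^ 2 ^ (k - 1)) R \<and> defines_MUBs G (2 ^ 2 ^ (k - 1)) R"
proof -
  interpret group G by fact
  let ?N = "{..2 * k}"
  obtain f where f: "bij_betw f ?N (carrier G)"
    using finite_same_card_bij[of ?N "carrier G"] assms by (auto simp: Coset.order_def)
  define f' where "f' = inv_into ?N f"
  have f_carrier [simp]: "f j \<in> carrier G" if "j \<le> 2 * k" for j
    using f that by (auto simp: bij_betw_def)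
  have f'_le [simp]: "f' x \<le> 2 * k" and f_f' [simp]: "f (f' x) = x" if "x \<in> carrier G" for x
    using f that bij_betw_apply[OF bij_betw_inv_into[OF f], of x]
    by (auto simp: f'_def bij_betw_inv_into_right)
  have f'_f [simp]: "f' (f j) = j" if "j \<le> 2 * k" for j
    using f that by (simp add: f'_def bij_betw_inv_into_left)
  \<comment> \<open>Left multiplication, transported to the indices of the \<open>2 * k + 1\<close>
    generators; all other indices are fixed so that \<open>permutes\<close> holds.\<close>
  define \<pi> where "\<pi> g j = (if j \<le> 2 * k then f' (g \<otimes> f j) else j)" for g j
  have \<pi>_mult: "\<pi> (g \<otimes> h) = \<pi> g \<circ> \<pi> h" if "g \<in> carrier G" "h \<in> carrier G" for g h
    using that by (auto simp: \<pi>_def fun_eq_iff m_assoc)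
  have \<pi>_one: "\<pi> \<one> = id"
    by (auto simp: \<pi>_def fun_eq_iff)
  have \<pi>_le: "\<pi> g j \<le> 2 * k" if "g \<in> carrier G" "j \<le> 2 * k" for g j
    using that by (simp add: \<pi>_def)
  have \<pi>_permutes: "\<pi> g permutes ?N" if g: "g \<in> carrier G" for g
  proof (rule bij_imp_permutes)
    have inverse: "\<pi> (inv g) (\<pi> g j) = j" "\<pi> g (\<pi> (inv g) j) = j" for j
      using fun_cong[OF \<pi>_mult[of "inv g" g], of j] fun_cong[OF \<pi>_mult[of g "inv g"], of j] g
      by (simp_all add: \<pi>_one)
    show "bij_betw (\<pi> g) ?N ?N"
      by (rule bij_betw_byWitness[where f' = "\<pi> (inv g)"]) (use g in \<open>auto simp: inverse \<pi>_le\<close>)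
  qed (simp add: \<pi>_def)
  \<comment> \<open>The choice is harmless: lifts are unique on \<open>V\<close>, so they compose
    exactly as the permutations do.\<close>
  define act where "act g = (SOME T. implements (\<pi> g) T)" for g
  have act: "implements (\<pi> g) (act g)" if "g \<in> carrier G" for g
    unfolding act_def by (rule someI_ex[OF implements_permutation[OF \<pi>_permutes[OF that]]])
  have act_V: "act g v \<in> V" and act_form: "form (act g v) (act g v) = form v v"
    and act_cliff: "j \<le> 2 * k \<Longrightarrow> act g (cliff j v) = cliff (\<pi> g j) (act g v)"
    if "g \<in> carrier G" "v \<in> V" for g v j
    using act[OF that(1)] that(2) by (auto simp: implements_def)
  have act_add: "act g (u + v) = act g u + act g v" if "g \<in> carrier G" "u \<in> V" "v \<in> V" for g u v
    using act[OF that(1)] that by (auto simp: implements_def)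
  have act_inj: "inj_on (act g) V" if "g \<in> carrier G" for g
    using act[OF that] by (simp add: implements_def)
  have act_zero: "act g 0 = 0" if "g \<in> carrier G" for g
    using act_add[OF that, of 0 0] by simp
  have act_mult: "act (g \<otimes> h) v = act g (act h v)"
    if gh: "g \<in> carrier G" "h \<in> carrier G" and v: "v \<in> V" for g h v
  proof -
    have "implements (\<pi> (g \<otimes> h)) (act g \<circ> act h)"
      unfolding \<pi>_mult[OF gh] using act gh \<pi>_le by (intro implements_comp)
    then show ?thesis
      using implements_unique[OF act _ \<pi>_permutes v, of "g \<otimes> h"] gh by fastforce
  qed
  have act_one: "act \<one> v = v" if "v \<in> V" for v
    using implements_id_unique[of "act \<one>"] act[of \<one>] that by (simp add: \<pi>_one)
  \<comment> \<open>Multiplicative average of \<open>form\<close> over the group: reindexing makes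
    it invariant, which \<open>form\<close> itself need not be.\<close>
  define \<beta> where "\<beta> u v = (\<Prod>g\<in>carrier G. bit_sign (form (act g u) (act g v)))" for u v
  have beta_square: "\<beta> u v * \<beta> u v = 1" for u v
    by (simp add: \<beta>_def bit_sign_square flip: prod.distrib)
  have beta_left: "\<beta> (u + v) w = \<beta> u w * \<beta> v w" if "u \<in> V" "v \<in> V" "w \<in> V" for u v w
    unfolding \<beta>_def prod.distrib[symmetric]
    by (rule prod.cong) (simp_all add: that act_add form_add_left bit_sign_add)
  have beta_right: "\<beta> u (v + w) = \<beta> u v * \<beta> u w" if "u \<in> V" "v \<in> V" "w \<in> V" for u v w
    unfolding \<beta>_def prod.distrib[symmetric]
    by (rule prod.cong) (simp_all add: that act_add form_add_right bit_sign_add)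
  have beta_act: "\<beta> (act h u) (act h v) = \<beta> u v" if "h \<in> carrier G" "u \<in> V" "v \<in> V" for h u v
  proof -
    have "\<beta> (act h u) (act h v) = (\<Prod>g\<in>carrier G. bit_sign (form (act (g \<otimes> h) u) (act (g \<otimes> h) v)))"
      unfolding \<beta>_def by (rule prod.cong) (simp_all add: that act_mult)
    also have "\<dots> = \<beta> u v"
      unfolding \<beta>_def
      by (rule prod.reindex_bij_witness[of _ "\<lambda>g. g \<otimes> inv h" "\<lambda>g. g \<otimes> h"])
        (use that in \<open>auto simp: m_assoc\<close>)
    finally show ?thesis .
  qed
  have polar_act: "form (act g u) (act g v) + form (act g v) (act g u) = form u v + form v u"
    if g: "g \<in> carrier G" and uv: "u \<in> V" "v \<in> V" for g u v
  proof -
    have "form (act g (u + v)) (act g (u + v)) = form (u + v) (u + v)"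
      using act_form[OF g add_V[OF uv]] .
    then show ?thesis
      unfolding act_add[OF g uv] form_add_self using act_form[OF g] uv by simp
  qed
  \<comment> \<open>The polar form is invariant, so every factor contributes the same sign, and an
    odd number of equal signs multiplies to that sign.\<close>
  have beta_swap: "\<beta> u v * \<beta> v u = bit_sign (form u v + form v u)" if "u \<in> V" "v \<in> V" for u v
  proof -
    have "\<beta> u v * \<beta> v u = (\<Prod>g\<in>carrier G. bit_sign (form u v + form v u))"
      unfolding \<beta>_def prod.distrib[symmetric]
      by (rule prod.cong) (use that in \<open>simp_all flip: bit_sign_add add: polar_act\<close>)
    also have "\<dots> = bit_sign (form u v + form v u) ^ (2 * k + 1)"
      using order by (simp add: Coset.order_def)
    also have "\<dots> = bit_sign (form u v + form v u)"
      by (simp add: bit_sign_def)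
    finally show ?thesis .
  qed
  have beta_W: "\<beta> w w = 1" if "w \<in> W" for w
    unfolding \<beta>_def by (rule prod.neutral) (use that W_sub in \<open>auto simp: act_form form_W\<close>)
  have W_zero: "0 \<in> W"
    by (simp add: W_iff)
  have W_V: "w \<in> V" if "w \<in> W" for w
    using that W_sub by blast
  have "\<exists>\<chi>. (\<forall>w\<in>W. \<chi> w * \<chi> w = 1) \<and> (\<forall>u\<in>W. \<forall>w\<in>W. \<chi> (u + w) = \<chi> u * \<chi> w * \<beta> u w)"
    by (rule exists_quadratic_refinement[OF finite_subset[OF W_sub finite_V] W_zero W_add])
      (simp_all add: W_V beta_square beta_left beta_right beta_W)
  then obtain \<chi> where \<chi>_square: "\<And>w. w \<in> W \<Longrightarrow> \<chi> w * \<chi> w = 1"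
    and \<chi>_add: "\<And>u w. u \<in> W \<Longrightarrow> w \<in> W \<Longrightarrow> \<chi> (u + w) = \<chi> u * \<chi> w * \<beta> u w"
    by blast
  \<comment> \<open>Left multiplication is free, so \<open>\<pi> g 0 \<noteq> 0\<close>. The vector
    \<open>act g w\<close> is killed by two distinct generators, whose anticommutator is the
    identity; hence it is 0.\<close>
  have disjoint: "w = 0" if g: "g \<in> carrier G" "g \<noteq> \<one>" and w: "w \<in> W" "act g w \<in> W" for g w
  proof -
    have wV: "w \<in> V"
      using w W_sub by blast
    have "\<pi> g 0 \<noteq> 0"
    proof
      assume "\<pi> g 0 = 0"
      then have "f (f' (g \<otimes> f 0)) = f 0"
        by (simp add: \<pi>_def)
      then have "g \<otimes> f 0 = \<one> \<otimes> f 0"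
        using g by simp
      then show False
        using g by (simp del: l_one)
    qed
    moreover have "cliff (\<pi> g 0) (act g w) = 0"
      using act_cliff[OF g(1) wV, of 0] w by (simp add: W_iff act_zero g)
    moreover have "cliff 0 (act g w) = 0"
      using w by (simp add: W_iff)
    ultimately have "act g w = 0"
      using cliff_anticommute[of "\<pi> g 0" 0 "act g w"] by simp
    then show ?thesis
      using inj_onD[OF act_inj[OF g(1)], of w 0] wV by (simp add: act_zero g)
  qed
  interpret lagrangian_orbit G V W Y \<beta> \<chi> act
  proof unfold_locales
    fix s assume s: "s \<in> V" and sym: "\<And>w. w \<in> W \<Longrightarrow> \<beta> w s = \<beta> s w"
    show "s \<in> W"
    proof (rule W_maximal[OF s])
      fix w assume w: "w \<in> W"
      then have "bit_sign (form w s + form s w) = 1"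
        using beta_swap[of w s] sym[OF w] s W_sub beta_square[of s w] by auto
      then show "form w s + form s w = 0"
        by (simp add: bit_sign_def split: if_splits)
    qed
  qed (use finite_V add_V W_sub W_zero W_add W_transversal beta_square beta_left beta_right \<chi>_square
      \<chi>_add act_V act_add act_mult act_one beta_act disjoint card_V in \<open>auto simp: Y_def\<close>)
  show ?thesis
    using flat_representation_exists[OF assms(2)] order by (simp add: card_W)
qed

end

theorem corollary4:
  fixes G :: "('a, 'b) monoid_scheme" and k :: nat
  assumes "group G"
    and "finite (carrier G)"
    and "Coset.order G = 2 * k + 1"
    and "k \<ge> 3"
  shows "\<exists>R. real_representation G (2 ^ (2 ^ (k - 1))) R \<and>
             defines_MUBs G (2 ^ (2 ^ (k - 1))) R"
proof -
  interpret spin_module k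
    by unfold_locales fact
  show ?thesis
    using assms(1-3) by (rule flat_representation)
qed

end
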